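(* Assume: (i) $F$ is bounded from below, strictly convex and Fréchet differentiable on $Y$, and $\nabla F:Y\to Y$ is Lipschitz continuous on compact subsets of $Y$; (ii) for every $\alpha\ge 0$ the sublevel set $\{u\in\mathcal M : \mathcal G(u)\le\alpha\}$ is weak* compact; (iii) whenever $\{u_k\}_k\subset\operatorname{dom}(\mathcal G)$ and $u_k\rightharpoonup^* u$ for some $u\in\mathcal M$, then $Ku_k\to Ku$ strongly in $Y$. Assume furthermore: (iv) there are a neighborhood $\mathcal N(\bar y)$ of $\bar y$ in $Y$ and $\theta>0$ with $(\nabla F(y_1)-\nabla F(y_2),y_1-y_2)_Y\ge\theta\|y_1-y_2\|_Y^2$ for all $y_1,y_2\in\mathcal N(\bar y)$; (v) there are $N\ge1$ and (distinct) points $\bar u_1,\dots,\bar u_N\in\operatorname{Ext}(B)$ with $\arg\max_{v\in\mathcal B}\langle\bar p,v\rangle=\{v\in\mathcal B:\langle\bar p,v\rangle=1\}=\{\bar u_i\}_{i=1}^N$; (vi) $\{K\bar u_i\}_{i=1}^N\subset Y$ is linearly independent; (vii) the minimizer $\bar u$ of $J$ over $\mathcal M$ (which under (i)-(iii), (v), (vi) is unique and of the form $\bar u=\sum_{i=1}^N\bar\lambda_i\bar u_i$, $\bar\lambda_i\ge0$) satisfies $\bar\lambda_i>0$ for all $i$; (viii) there exist a function $g:\operatorname{Ext}(B)\times\operatorname{Ext}(B)\to[0,\infty)$, constants $\tau,\kappa>0$ and pairwise disjoint $d_{\mathcal B}$-closed neighborhoods $\bar U_i$ of $\bar u_i$ in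 $\mathcal B$, $i=1,\dots,N$, such that for all $i$ and all $u\in\bar U_i\cap\operatorname{Ext}(B)$ $$\|K(u-\bar u_i)\|_Y\le\tau\, g(u,\bar u_i),\qquad 1-\langle\bar p,u\rangle\ge\kappa\, g(u,\bar u_i)^2 .$$ Let $\{\mu_k\}_k$ be an infinite sequence generated by the PDAP algorithm (described in the context; i.e. the algorithm does not terminate after finitely many steps), and let $\bar\mu=\sum_{i=1}^N\bar\lambda_i\delta_{\bar u_i}$, which is the unique minimizer of $j$ over $M^+(\mathcal B)$. Write $r_j(\mu)=j(\mu)-\min_{M^+(\mathcal B)}j$. Then $\mu_k\rightharpoonup^*\bar\mu$ in $M(\mathcal B)$. Moreover, there are $\bar k\in\mathbb N$ and $\zeta\in[3/4,1)$ such that $r_j(\mu_{k+1})\le\zeta\,r_j(\mu_k)$ for all $k\ge\bar k$. In particular, there is $c>0$ with $r_j(\mu_k)\le c\,\zeta^k$ for all $k\in\mathbb N$ sufficiently large.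
   Context: Setting: $\mathcal C$ is a separable real Banach space, $\mathcal M=\mathcal C^*$ its topological dual with the dual norm, $\langle p,u\rangle$ denotes the duality pairing. $Y$ is a real Hilbert space, $F:Y\to\mathbb R$ is convex, $K:\mathcal M\to Y$ is linear and weak*-to-weak continuous with continuous pre-adjoint $K_*:Y\to\mathcal C$, $\langle K_*y,u\rangle=(Ku,y)_Y$. $\mathcal G:\mathcal M\to[0,\infty]$ is convex, weak* lower semicontinuous and positively one-homogeneous. $J(u)=F(Ku)+\mathcal G(u)$; $\operatorname{dom}(\mathcal G)=\{u:\mathcal G(u)<\infty\}$; $B=\{u\in\mathcal M:\mathcal G(u)\le1\}$; $\operatorname{Ext}(B)$ is its set of extremal points; $\mathcal B=\overline{\operatorname{Ext}(B)}^{*}$ (weak* closure), and $d_{\mathcal B}$ is a metric on $\mathcal B$ metrizing the weak* topology, so $(\mathcal B,d_{\mathcal B})$ is compact. Under (i)-(iii) $J$ has a minimizer and $K\bar u$ is the same for all minimizers $\bar u$; set $\bar y=K\bar u$, $\bar p=-K_*\nabla F(\bar y)\in\mathcal C$. $M(\mathcal B)=C(\mathcal B)^*$ is the space of finite Radon measures on $\mathcal B$ with total variation norm, $M^+(\mathcal B)$ the positive ones. $\mathcal K:M(\mathcal B)\to Y$ is the linear continuous operator with $(\mathcal K\mu,y)_Y=\int_{\mathcal B}(Kv,y)_Y\,d\mu(v)$ for all $y\in Y$; it is the adjoint of $\mathcal K_*:Y\to C(\mathcal B)$, $[\mathcal K_*y](v)=\langle K_*y,v\rangle$. $j(\mu)=F(\mathcal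 K\mu)+\|\mu\|_{M(\mathcal B)}$ for $\mu\in M^+(\mathcal B)$. For a finite set $\mathcal A=\{u_i\}_{i=1}^n\subset\operatorname{Ext}(B)$, $M^+(\mathcal A)=\{\sum_i\lambda_i\delta_{u_i}:\lambda_i\ge0\}$. PDAP algorithm. Initialize with a finite set $\mathcal A_0=\{u^0_i\}_{i=1}^{N_0}\subset\operatorname{Ext}(B)$ and $\mu_0=\sum_i\lambda^0_i\delta_{u^0_i}$, $\lambda^0_i>0$. For $k=0,1,\dots$, given the finite set $\mathcal A_k\subset\operatorname{Ext}(B)$ and $\mu_k\in M^+(\mathcal A_k)$: (a) compute $P_k=-\mathcal K_*\nabla F(\mathcal K\mu_k)\in C(\mathcal B)$ and some $\widehat v_k\in\arg\max_{v\in\operatorname{Ext}(B)}P_k(v)$ (a maximizer exists); (b) if $k\ge1$ and $P_k(\widehat v_k)\le1$, terminate with $\mu_k$; (c) set $\mathcal A_k^+=\mathcal A_k\cup\{\widehat v_k\}$; (d) choose any $\mu_{k+1}\in\arg\min_{\mu\in M^+(\mathcal A_k^+)}j(\mu)$; (e) set $\mathcal A_{k+1}=\operatorname{supp}\mu_{k+1}$. *)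

theory Defs
  imports "HOL-Analysis.Analysis"
begin

subsection \<open>Functional-analytic notions\<close>

text \<open>
  The dual of \<open>'c\<close> is the type of bounded linear functionals with the operator norm, and the
  pairing of \<open>p\<close> with \<open>u\<close> is \<open>blinfun_apply u p\<close>. For scalar-valued operators the strong operator
  topology is the topology of pointwise convergence on \<open>'c\<close>, i.e. the weak* topology.
\<close>

type_synonym 'c dual = "'c \<Rightarrow>\<^sub>L real"

abbreviation weak_star :: "('c::real_normed_vector dual) topology" where
  "weak_star \<equiv> strong_operator_topology"

definition weak_topology :: "'y::real_inner topology" where
  "weak_topology = pullback_topology UNIV (\<lambda>x y. inner x y) euclidean"

definition strictly_convex :: "('a::real_vector \<Rightarrow> real) \<Rightarrow> bool" where
  "strictly_convex F \<longleftrightarrow> (\<forall>x y t. x \<noteq> y \<longrightarrow> 0 < t \<longrightarrow> t < 1 \<longrightarrow>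
     F ((1 - t) *\<^sub>R x + t *\<^sub>R y) < (1 - t) * F x + t * F y)"

definition gradient :: "('y::real_inner \<Rightarrow> real) \<Rightarrow> 'y \<Rightarrow> 'y" where
  "gradient F y = (THE g. GDERIV F y :> g)"

definition convex_ennreal :: "('a::real_vector \<Rightarrow> ennreal) \<Rightarrow> bool" where
  "convex_ennreal G \<longleftrightarrow> (\<forall>u v t. 0 \<le> t \<longrightarrow> t \<le> 1 \<longrightarrow>
     G ((1 - t) *\<^sub>R u + t *\<^sub>R v) \<le> ennreal (1 - t) * G u + ennreal t * G v)"

definition lower_semicontinuous :: "'a topology \<Rightarrow> ('a \<Rightarrow> ennreal) \<Rightarrow> bool" where
  "lower_semicontinuous X G \<longleftrightarrow> (\<forall>a. closedin X {u \<in> topspace X. G u \<le> a})"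

text \<open>
  Only positive factors are used. Since \<open>0 * \<infinity> = 0\<close> in \<open>ennreal\<close>, admitting the factor 0 would add
  \<open>G 0 = 0\<close>, which follows from lower semicontinuity as soon as \<open>G\<close> is finite somewhere.
\<close>

definition pos_homogeneous :: "('a::real_vector \<Rightarrow> ennreal) \<Rightarrow> bool" where
  "pos_homogeneous G \<longleftrightarrow> (\<forall>u t. 0 < t \<longrightarrow> G (t *\<^sub>R u) = ennreal t * G u)"


subsection \<open>Positive measures on a compact metrizable space\<close>

definition borel_of_topology :: "'a topology \<Rightarrow> 'a measure" where
  "borel_of_topology X = sigma (topspace X) {U. openin X U}"

text \<open>
  On a compact metrizable space every finite Borel measure is Radon, so this is the cone of
  positive elements of the dual of \<open>C(X)\<close>. The total variation norm of such a measure is its total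
  mass.
\<close>

definition pos_measures :: "'a topology \<Rightarrow> 'a measure set" where
  "pos_measures X = {\<mu>. sets \<mu> = sets (borel_of_topology X) \<and> finite_measure \<mu>}"

definition dirac_sum :: "'a topology \<Rightarrow> 'i set \<Rightarrow> ('i \<Rightarrow> real) \<Rightarrow> ('i \<Rightarrow> 'a) \<Rightarrow> 'a measure" where
  "dirac_sum X I lam u = measure_of (topspace X) (sets (borel_of_topology X))
     (\<lambda>E. \<Sum>i\<in>I. ennreal (lam i) * indicator E (u i))"

definition pos_measures_on :: "'a topology \<Rightarrow> 'a set \<Rightarrow> 'a measure set" where
  "pos_measures_on X A = {dirac_sum X A lam (\<lambda>u. u) | lam. \<forall>u\<in>A. 0 \<le> lam u}"

definition msupport :: "'a topology \<Rightarrow> 'a measure \<Rightarrow> 'a set" where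
  "msupport X \<mu> = {v \<in> topspace X. \<forall>U. openin X U \<longrightarrow> v \<in> U \<longrightarrow> emeasure \<mu> U \<noteq> 0}"

definition weak_star_converges ::
  "'a topology \<Rightarrow> (nat \<Rightarrow> 'a measure) \<Rightarrow> 'a measure \<Rightarrow> bool" where
  "weak_star_converges X \<mu> \<nu> \<longleftrightarrow> (\<forall>f. continuous_map X euclideanreal f \<longrightarrow>
     (\<lambda>k. \<integral>v. f v \<partial>\<mu> k) \<longlonglongrightarrow> (\<integral>v. f v \<partial>\<nu>))"


subsection \<open>The minimization problem and its lifting to measures\<close>

definition unit_sublevel :: "('c::real_normed_vector dual \<Rightarrow> ennreal) \<Rightarrow> 'c dual set" where
  "unit_sublevel G = {u. G u \<le> 1}"

definition Ext :: "('c::real_normed_vector dual \<Rightarrow> ennreal) \<Rightarrow> 'c dual set" where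
  "Ext G = {u. u extreme_point_of unit_sublevel G}"

definition Ext_closure :: "('c::real_normed_vector dual \<Rightarrow> ennreal) \<Rightarrow> 'c dual set" where
  "Ext_closure G = weak_star closure_of Ext G"

definition Ext_topology :: "('c::real_normed_vector dual \<Rightarrow> ennreal) \<Rightarrow> 'c dual topology" where
  "Ext_topology G = subtopology weak_star (Ext_closure G)"

definition objective ::
  "('y \<Rightarrow> real) \<Rightarrow> ('c::real_normed_vector dual \<Rightarrow> 'y) \<Rightarrow> ('c dual \<Rightarrow> ennreal) \<Rightarrow> 'c dual \<Rightarrow> ereal"
where
  "objective F K G u = ereal (F (K u)) + enn2ereal (G u)"

text \<open>
  The weak (Pettis) integral of \<open>K\<close>; the Bochner integral of the library is not available because
  \<open>'y\<close> is not assumed to be separable.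
\<close>

definition lifted_op ::
  "('c::real_normed_vector dual \<Rightarrow> 'y::real_inner) \<Rightarrow> 'c dual measure \<Rightarrow> 'y" where
  "lifted_op K \<mu> = (THE z. \<forall>y. inner z y = (\<integral>v. inner (K v) y \<partial>\<mu>))"

definition lifted_objective ::
  "('y::real_inner \<Rightarrow> real) \<Rightarrow> ('c::real_normed_vector dual \<Rightarrow> 'y) \<Rightarrow> 'c dual measure \<Rightarrow> real" where
  "lifted_objective F K \<mu> = F (lifted_op K \<mu>) + measure \<mu> (space \<mu>)"

definition residual ::
  "('y::real_inner \<Rightarrow> real) \<Rightarrow> ('c::real_normed_vector dual \<Rightarrow> 'y) \<Rightarrow> ('c dual \<Rightarrow> ennreal)
    \<Rightarrow> 'c dual measure \<Rightarrow> real" where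
  "residual F K G \<mu> = lifted_objective F K \<mu>
     - (INF \<nu>\<in>pos_measures (Ext_topology G). lifted_objective F K \<nu>)"

text \<open>The argument \<open>Kpre\<close> is the pre-adjoint of \<open>K\<close>.\<close>

definition dual_variable ::
  "('y::real_inner \<Rightarrow> real) \<Rightarrow> ('y \<Rightarrow>\<^sub>L 'c::real_normed_vector) \<Rightarrow> 'y \<Rightarrow> 'c" where
  "dual_variable F Kpre y = - blinfun_apply Kpre (gradient F y)"


subsection \<open>The PDAP algorithm\<close>

text \<open>
  \<open>pdap_sequence\<close> describes the infinite runs: the stopping criterion, which is tested from the
  second iteration on, is never met.
\<close>

definition pdap_sequence ::
  "('y::real_inner \<Rightarrow> real) \<Rightarrow> ('c::real_normed_vector dual \<Rightarrow> 'y) \<Rightarrow> ('y \<Rightarrow>\<^sub>L 'c)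
    \<Rightarrow> ('c dual \<Rightarrow> ennreal) \<Rightarrow> (nat \<Rightarrow> 'c dual set) \<Rightarrow> (nat \<Rightarrow> 'c dual)
    \<Rightarrow> (nat \<Rightarrow> 'c dual measure) \<Rightarrow> bool" where
  "pdap_sequence F K Kpre G A vhat \<mu> \<longleftrightarrow>
     (let P = (\<lambda>k v. blinfun_apply v (dual_variable F Kpre (lifted_op K (\<mu> k)))) in
       finite (A 0) \<and> A 0 \<subseteq> Ext G \<and>
       (\<exists>lam. (\<forall>u\<in>A 0. 0 < lam u) \<and> \<mu> 0 = dirac_sum (Ext_topology G) (A 0) lam (\<lambda>u. u)) \<and>
       (\<forall>k. is_arg_max (P k) (\<lambda>v. v \<in> Ext G) (vhat k)) \<and>
       (\<forall>k\<ge>1. P k (vhat k) > 1) \<and>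
       (\<forall>k. is_arg_min (lifted_objective F K)
              (\<lambda>\<nu>. \<nu> \<in> pos_measures_on (Ext_topology G) (insert (vhat k) (A k))) (\<mu> (Suc k))) \<and>
       (\<forall>k. A (Suc k) = msupport (Ext_topology G) (\<mu> (Suc k))))"

end

theory Submission
  imports Defs
begin

text \<open>
  Put \<open>q v = 1 - \<langle>pbar, v\<rangle>\<close>, which is nonnegative on the compact space of extremal points and vanishes
  exactly at the \<open>u i\<close>. For every positive measure \<open>\<nu>\<close> the excess \<open>j \<nu> - j \<mu>bar\<close> is the Bregman distance
  of \<open>F\<close> from \<open>ybar\<close> to the observation of \<open>\<nu>\<close> plus the integral of \<open>q\<close>; both terms are nonnegative,
  which gives minimality and uniqueness of \<open>\<mu>bar\<close>. After a step of the algorithm the dual variable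
  \<open>P k\<close> equals 1 on the active set, so by convexity the residual is at most the mass of \<open>\<mu>bar\<close> times
  \<open>P k (vhat k) - 1\<close>, and replacing a fraction \<open>s\<close> of the measure by an atom at \<open>vhat k\<close> decreases the
  residual by at least \<open>s\<close> times itself up to \<open>O(s\<^sup>2)\<close>. Hence the residuals tend to 0, and a
  compactness argument yields weak* convergence. Eventually \<open>vhat k\<close> lies in some \<open>U i\<close>, and it suffices to
  move only the mass in \<open>U i\<close>; the quadratic growth of \<open>q\<close> then bounds the \<open>O(s\<^sup>2)\<close> term by
  \<open>s\<^sup>2\<close> times the residual, so that a fixed small \<open>s\<close> gives a linear rate.
\<close>

subsection \<open>Hilbert space and compactness tools\<close>

text \<open>For small \<open>t\<close> of sign opposite to \<open>a\<close> the linear term would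
  win. This is the first-order condition at a minimum of a quadratic function.\<close>

lemma quadratic_nonneg_imp_linear_zero:
  fixes a b :: real
  assumes "\<And>t. 0 \<le> t * a + t\<^sup>2 * b"
  shows "a = 0"
proof (rule ccontr)
  assume "a \<noteq> 0"
  define M where "M = \<bar>b\<bar> + 1"
  have M: "0 < M" "b < M" by (auto simp: M_def)
  \<comment> \<open>Since \<open>M\<close> exceeds \<open>b\<close>, the step \<open>- a / M\<close>
    is short enough that the quadratic term cannot compensate the linear one.\<close>
  have "0 \<le> (- a / M) * a + (- a / M)\<^sup>2 * b" by (rule assms)
  also have "\<dots> = a\<^sup>2 / M\<^sup>2 * (b - M)"
    using M by (simp add: field_simps power2_eq_square)
  also have "\<dots> < 0"
    using M \<open>a \<noteq> 0\<close> by (intro mult_pos_neg) auto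
  finally show False by simp
qed

text \<open>The representing vector is the minimizer of \<open>z \<mapsto> \<parallel>z\<parallel>\<^sup>2 / 2 - f z\<close>; minimizing sequences
  are Cauchy by the parallelogram law.\<close>

lemma riesz_representation:
  fixes f :: "'a::{real_inner,complete_space} \<Rightarrow> real"
  assumes f: "bounded_linear f"
  obtains z where "\<And>y. f y = inner z y"
proof -
  interpret f: bounded_linear f by fact
  define \<psi> where "\<psi> z = (norm z)\<^sup>2 / 2 - f z" for z
  obtain C where C: "\<And>x. norm (f x) \<le> norm x * C" using f.bounded by blast
  have low: "- (C\<^sup>2 / 2) \<le> \<psi> z" for z
  proof -
    have "f z \<le> norm z * C" using C[of z] by simp
    moreover have "0 \<le> (norm z - C)\<^sup>2" by simp
    ultimately show ?thesis unfolding \<psi>_def power2_diff by (simp add: algebra_simps)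
  qed
  hence bdd: "bdd_below (range \<psi>)" by (auto intro!: bdd_belowI2)
  define m where "m = Inf (range \<psi>)"
  have m_le: "m \<le> \<psi> z" for z unfolding m_def using bdd by (simp add: cInf_lower)
  \<comment> \<open>The linear part of \<open>\<psi>\<close> drops out of the comparison with the
    midpoint, which leaves the parallelogram law.\<close>
  have par: "(norm (a - b))\<^sup>2 / 4 \<le> \<psi> a - m + (\<psi> b - m)" for a b
  proof -
    have "(norm (a - b))\<^sup>2 = 4 * (\<psi> a + \<psi> b - 2 * \<psi> ((1/2) *\<^sub>R (a + b)))"
      unfolding \<psi>_def power2_norm_eq_inner f.scaleR f.add
      by (simp add: inner_add inner_diff inner_commute field_simps)
    thus ?thesis using m_le[of "(1/2) *\<^sub>R (a + b)"] by simp
  qed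
  define \<rho> where "\<rho> n = inverse (real (Suc n))" for n
  have "\<exists>z. \<psi> z < m + \<rho> n" for n
    using cInf_lessD[of "range \<psi>" "m + \<rho> n"] by (auto simp: m_def \<rho>_def)
  then obtain Z where Z: "\<And>n. \<psi> (Z n) < m + \<rho> n" by metis
  have "Cauchy Z"
  proof (rule metric_CauchyI)
    fix e :: real assume "0 < e"
    then obtain M where M: "\<rho> M < e\<^sup>2 / 8"
      using reals_Archimedean[of "e\<^sup>2 / 8"] by (auto simp: \<rho>_def)
    show "\<exists>M. \<forall>i\<ge>M. \<forall>j\<ge>M. dist (Z i) (Z j) < e"
    proof (intro exI allI impI)
      fix i j assume ij: "M \<le> i" "M \<le> j"
      have "\<rho> i \<le> \<rho> M" "\<rho> j \<le> \<rho> M"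
        using ij by (auto simp: \<rho>_def intro!: le_imp_inverse_le)
      hence "\<psi> (Z i) - m + (\<psi> (Z j) - m) < e\<^sup>2 / 8 + e\<^sup>2 / 8"
        using Z[of i] Z[of j] M by linarith
      with par[of "Z i" "Z j"] have "(norm (Z i - Z j))\<^sup>2 / 4 < e\<^sup>2 / 8 + e\<^sup>2 / 8"
        by (rule le_less_trans)
      hence "(norm (Z i - Z j))\<^sup>2 < e\<^sup>2" by simp
      thus "dist (Z i) (Z j) < e"
        unfolding dist_norm using \<open>0 < e\<close> by (auto intro: power2_less_imp_less)
    qed
  qed
  then obtain z where z: "Z \<longlonglongrightarrow> z" using Cauchy_convergent_iff convergent_def by blast
  have "(\<lambda>n. \<psi> (Z n)) \<longlonglongrightarrow> \<psi> z"
    unfolding \<psi>_def by (intro tendsto_intros z f.tendsto) simp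
  moreover have "(\<lambda>n. m + \<rho> n) \<longlonglongrightarrow> m + 0"
    unfolding \<rho>_def by (intro tendsto_intros LIMSEQ_inverse_real_of_nat)
  ultimately have "\<psi> z \<le> m"
    using Z by (intro LIMSEQ_le[of "\<lambda>n. \<psi> (Z n)" "\<psi> z"]) (auto intro: less_imp_le)
  have "f y = inner z y" for y
  proof -
    \<comment> \<open>Minimality of \<open>z\<close> tested along the line in direction
      \<open>y\<close>.\<close>
    have "0 \<le> t * (inner z y - f y) + t\<^sup>2 * ((norm y)\<^sup>2 / 2)" for t
    proof -
      have "\<psi> (z + t *\<^sub>R y) = \<psi> z + (t * (inner z y - f y) + t\<^sup>2 * ((norm y)\<^sup>2 / 2))"
        unfolding \<psi>_def power2_norm_eq_inner f.scaleR f.add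
        by (simp add: inner_add inner_commute algebra_simps power2_eq_square add_divide_distrib)
      thus ?thesis using m_le[of "z + t *\<^sub>R y"] \<open>\<psi> z \<le> m\<close> by linarith
    qed
    from quadratic_nonneg_imp_linear_zero[OF this] show ?thesis by simp
  qed
  thus thesis using that by blast
qed

section \<open>Gradients and tangent inequalities of convex functions\<close>

lemma GDERIV_unique:
  assumes "GDERIV f x :> a" "GDERIV f x :> b"
  shows "a = b"
proof -
  have "(\<lambda>h. inner h a) = (\<lambda>h. inner h b)"
    using assms has_derivative_unique unfolding gderiv_def by blast
  hence "inner (a - b) a = inner (a - b) b" by metis
  hence "inner (a - b) (a - b) = 0" by (simp add: inner_diff_right)
  thus ?thesis by simp
qed

text \<open>The derivative is a bounded functional, so the Riesz representation turns it into a
  vector; uniqueness makes this the value of the \<open>THE\<close> in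
  \<open>gradient\<close>.\<close>

lemma GDERIV_gradient:
  fixes F :: "'y::{real_inner,complete_space} \<Rightarrow> real"
  assumes "F differentiable (at y)"
  shows "GDERIV F y :> gradient F y"
proof -
  obtain D where D: "(F has_derivative D) (at y)"
    using assms by (auto simp: differentiable_def)
  then obtain z where "\<And>h. D h = inner z h"
    using riesz_representation has_derivative_bounded_linear by blast
  hence "D = (\<lambda>h. inner h z)" by (auto simp: inner_commute)
  hence "GDERIV F y :> z" using D by (simp add: gderiv_def)
  thus ?thesis
    unfolding gradient_def using GDERIV_unique by (intro theI[of "\<lambda>g. GDERIV F y :> g" z]) blast+
qed

lemma GDERIV_along_line:
  assumes "GDERIV F (y + t *\<^sub>R h) :> D"
  shows "((\<lambda>s. F (y + s *\<^sub>R h)) has_real_derivative inner h D) (at t)"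
proof -
  have "((\<lambda>s. y + s *\<^sub>R h) has_derivative (\<lambda>s. s *\<^sub>R h)) (at t)"
    by (auto intro!: derivative_eq_intros)
  from has_derivative_compose[OF this assms[unfolded gderiv_def]]
  show ?thesis by (simp add: has_field_derivative_def mult.commute[of _ "inner h D"])
qed

text \<open>Restriction to the line through \<open>y\<close> and \<open>z\<close> reduces this to
  the tangent inequality on the reals.\<close>

lemma convex_on_above_gradient:
  fixes F :: "'y::real_inner \<Rightarrow> real"
  assumes F: "convex_on UNIV F" and D: "GDERIV F y :> D"
  shows "F y + inner D (z - y) \<le> F z"
proof -
  define \<phi> where "\<phi> s = F (y + s *\<^sub>R (z - y))" for s
  have "convex_on UNIV \<phi>"
  proof (rule convex_onI)
    fix t a b :: real assume t: "0 < t" "t < 1"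
    have "y + ((1 - t) *\<^sub>R a + t *\<^sub>R b) *\<^sub>R (z - y)
      = (1 - t) *\<^sub>R (y + a *\<^sub>R (z - y)) + t *\<^sub>R (y + b *\<^sub>R (z - y))"
      by (simp add: algebra_simps)
    thus "\<phi> ((1 - t) *\<^sub>R a + t *\<^sub>R b) \<le> (1 - t) * \<phi> a + t * \<phi> b"
      unfolding \<phi>_def using convex_onD[OF F] t by (metis UNIV_I less_imp_le)
  qed simp
  moreover have "(\<phi> has_real_derivative inner (z - y) D) (at 0)"
    unfolding \<phi>_def using D by (intro GDERIV_along_line) simp
  ultimately have "inner (z - y) D * (1 - 0) \<le> \<phi> 1 - \<phi> 0"
    by (intro convex_on_imp_above_tangent[of UNIV]) (auto simp: has_field_derivative_at_within)
  thus ?thesis by (simp add: \<phi>_def inner_commute)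
qed

text \<open>Strict convexity is used at the midpoint \<open>m\<close> and the plain tangent
  inequality from \<open>y\<close> to \<open>m\<close>; doubling gives a strict inequality at
  \<open>z\<close>.\<close>

lemma strictly_convex_above_gradient:
  fixes F :: "'y::real_inner \<Rightarrow> real"
  assumes F: "convex_on UNIV F" and S: "strictly_convex F" and D: "GDERIV F y :> D"
    and "z \<noteq> y"
  shows "F y + inner D (z - y) < F z"
proof -
  define t :: real where "t = 1/2"
  define m where "m = (1 - t) *\<^sub>R y + t *\<^sub>R z"
  have "F m < (1 - t) * F y + t * F z"
    unfolding m_def using \<open>z \<noteq> y\<close>
    by (intro S[unfolded strictly_convex_def, rule_format]) (auto simp: t_def)
  moreover have "m - y = t *\<^sub>R (z - y)" by (simp add: m_def algebra_simps)
  moreover have "F y + inner D (m - y) \<le> F m" by (rule convex_on_above_gradient[OF F D])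
  ultimately show ?thesis by (simp add: t_def)
qed

section \<open>Orthogonal projection and biorthogonal vectors\<close>

text \<open>A Gram-Schmidt step: \<open>e\<close> is the component of the new vector orthogonal to
  the old span, and the projection along \<open>e\<close> is added.\<close>

lemma projection_on_finite_span:
  fixes B :: "'a::real_inner set"
  assumes "finite B"
  shows "\<exists>p\<in>span B. \<forall>b\<in>B. inner (x - p) b = 0"
  using assms
proof (induction B arbitrary: x)
  case empty
  show ?case by auto
next
  case (insert b B)
  obtain p where p: "p \<in> span B" "\<forall>c\<in>B. inner (x - p) c = 0" using insert.IH by blast
  obtain p' where p': "p' \<in> span B" "\<forall>c\<in>B. inner (b - p') c = 0" using insert.IH by blast
  define e where "e = b - p'"
  \<comment> \<open>If \<open>e\<close> is 0, that is, if \<open>b\<close> already lies in the span,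
    the added term vanishes and \<open>r\<close> is \<open>p\<close>.\<close>
  define r where "r = p + (inner x e / inner e e) *\<^sub>R e"
  have spanB: "span B \<subseteq> span (insert b B)" by (rule span_mono) auto
  have e_orth: "inner e c = 0" if "c \<in> span B" for c
    using orthogonal_to_span[OF that, of e] p'(2) by (auto simp: e_def orthogonal_def)
  have e_span: "e \<in> span (insert b B)"
    unfolding e_def using p'(1) spanB by (intro span_diff) (auto intro: span_base)
  have r_span: "r \<in> span (insert b B)"
    unfolding r_def using p(1) spanB e_span by (auto intro!: span_add span_scale)
  have r_B: "inner (x - r) c = 0" if "c \<in> B" for c
  proof -
    have "inner e c = 0" using e_orth that by (simp add: span_base)
    thus ?thesis using p(2) that by (simp add: r_def inner_diff_left inner_add_left)
  qed
  have "inner p e = 0" using e_orth[OF p(1)] by (simp add: inner_commute)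
  hence r_e: "inner (x - r) e = 0"
    by (cases "e = 0") (simp_all add: r_def inner_diff_left inner_add_left)
  have "inner (x - r) p' = 0"
    using orthogonal_to_span[OF p'(1), of "x - r"] r_B by (auto simp: orthogonal_def)
  hence "inner (x - r) b = 0" using r_e by (simp add: e_def inner_diff_right)
  thus ?case using r_span r_B by blast
qed

text \<open>The part of \<open>b i\<close> orthogonal to the other vectors is nonzero by
  independence and, suitably scaled, is the wanted \<open>w i\<close>. Injectivity ensures that
  distinct indices give distinct vectors.\<close>

lemma dual_family:
  fixes b :: "'i \<Rightarrow> 'a::real_inner"
  assumes I: "finite I" and inj: "inj_on b I" and ind: "independent (b ` I)"
  obtains w where "\<And>i j. i \<in> I \<Longrightarrow> j \<in> I \<Longrightarrow> inner (w i) (b j) = (if i = j then 1 else 0)"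
proof -
  have "\<exists>w. \<forall>j\<in>I. inner w (b j) = (if i = j then 1 else 0)" if i: "i \<in> I" for i
  proof -
    obtain p where p: "p \<in> span (b ` I - {b i})" "\<forall>c\<in>b ` I - {b i}. inner (b i - p) c = 0"
      using projection_on_finite_span[of "b ` I - {b i}" "b i"] I by auto
    define e where "e = b i - p"
    have "e \<noteq> 0"
      using p(1) ind i unfolding e_def dependent_def by auto
    have "inner e p = 0"
      using orthogonal_to_span[OF p(1), of e] p(2) by (auto simp: e_def orthogonal_def)
    hence ei: "inner e (b i) = inner e e" by (simp add: e_def inner_diff_right)
    have ej: "inner e (b j) = 0" if "j \<in> I" "j \<noteq> i" for j
      using p(2) that inj i by (auto simp: e_def inj_on_def)
    show ?thesis
      using ei ej \<open>e \<noteq> 0\<close> by (intro exI[of _ "(1 / inner e e) *\<^sub>R e"]) auto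
  qed
  thus thesis using that by metis
qed

section \<open>Compact convex hulls and domination by a nonnegative function\<close>

text \<open>Mazur's theorem by total boundedness: \<open>S\<close> has a finite net
  \<open>T\<close>, the hull of \<open>T\<close> is compact and has a finite net itself, and three
  distances below \<open>e/4\<close> add up to less than \<open>e\<close>.\<close>

lemma compact_closure_convex_hull:
  fixes S :: "'a::{real_normed_vector,complete_space} set"
  assumes S: "compact S"
  shows "compact (closure (convex hull S))"
  unfolding compact_eq_totally_bounded
proof (intro conjI allI impI)
  show "complete (closure (convex hull S))" by (simp add: complete_eq_closed)
  fix e :: real assume e: "0 < e"
  have e4: "0 < e/4" using e by simp
  obtain T where T: "finite T" "S \<subseteq> (\<Union>x\<in>T. ball x (e/4))"
    using S e4 unfolding compact_eq_totally_bounded by blast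
  have near: "\<exists>y\<in>convex hull T. dist x y < e/4" if "x \<in> convex hull S" for x
  proof -
    \<comment> \<open>Written as the sum of a ball and a convex hull, the neighbourhood
      \<open>N\<close> is convex; hence it contains the hull of \<open>S\<close> as soon as it
      contains \<open>S\<close>.\<close>
    define N where "N = {x. \<exists>y\<in>convex hull T. dist x y < e/4}"
    have N: "N = (\<Union>h\<in>ball 0 (e/4). \<Union>y\<in>convex hull T. {h + y})"
      unfolding N_def
    proof safe
      fix x y assume "y \<in> convex hull T" "dist x y < e/4"
      thus "x \<in> (\<Union>h\<in>ball 0 (e/4). \<Union>y\<in>convex hull T. {h + y})"
        using UN_I[of "x - y" "ball 0 (e/4)" x "\<lambda>h. \<Union>y\<in>convex hull T. {h + y}"]
        by (force simp: dist_norm norm_minus_commute)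
    next
      fix x h y assume "h \<in> ball (0::'a) (e/4)" "y \<in> convex hull T"
      thus "\<exists>z\<in>convex hull T. dist (h + y) z < e/4"
        by (intro bexI[of _ y]) (auto simp: dist_norm)
    qed
    have "convex N" unfolding N by (intro convex_sums convex_ball convex_convex_hull)
    moreover have "S \<subseteq> N"
      using T(2) unfolding N_def by (force simp: dist_commute hull_inc)
    ultimately have "convex hull S \<subseteq> N" by (simp add: hull_minimal)
    thus ?thesis using that by (auto simp: N_def)
  qed
  have "compact (convex hull T)" using T(1) by (rule finite_imp_compact_convex_hull)
  then obtain k where k: "finite k" "convex hull T \<subseteq> (\<Union>x\<in>k. ball x (e/4))"
    using e4 unfolding compact_eq_totally_bounded by blast
  have "x \<in> (\<Union>z\<in>k. ball z e)" if "x \<in> closure (convex hull S)" for x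
  proof -
    obtain a where a: "a \<in> convex hull S" "dist a x < e/4"
      using \<open>x \<in> closure (convex hull S)\<close> e4 unfolding closure_approachable by blast
    obtain b where b: "b \<in> convex hull T" "dist a b < e/4" using near a by blast
    obtain c where c: "c \<in> k" "dist c b < e/4" using k b by (auto simp: subset_iff)
    have "dist c x < e"
      using a b c dist_triangle[of c x b] dist_triangle[of b x a] e by (simp add: dist_commute)
    thus ?thesis using c by auto
  qed
  thus "\<exists>k. finite k \<and> closure (convex hull S) \<subseteq> (\<Union>x\<in>k. ball x e)" using k(1) by blast
qed

text \<open>The points are scaled by the mass bound \<open>M\<close>, the weights are normalized,
  and the missing mass \<open>1 - t / M\<close> is placed at 0.\<close>

lemma weighted_sum_in_convex_hull:
  fixes f :: "'i \<Rightarrow> 'a::real_vector"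
  assumes "finite I" "\<And>i. i \<in> I \<Longrightarrow> 0 \<le> c i" "sum c I \<le> M" "0 < M"
    and "\<And>i. i \<in> I \<Longrightarrow> M *\<^sub>R f i \<in> S" "0 \<in> S"
  shows "(\<Sum>i\<in>I. c i *\<^sub>R f i) \<in> convex hull S"
proof -
  define t where "t = sum c I"
  have t0: "0 \<le> t" unfolding t_def using assms(2) by (rule sum_nonneg)
  show ?thesis
  proof (cases "t = 0")
    case True
    hence "\<forall>i\<in>I. c i = 0" using assms(1,2) by (simp add: t_def sum_nonneg_eq_0_iff)
    thus ?thesis using assms(6) by (simp add: hull_inc)
  next
    case False
    have "(\<Sum>i\<in>I. (c i / t) *\<^sub>R (M *\<^sub>R f i)) \<in> convex hull S"
      using assms(1,2,5) False t0
      by (intro convex_sum) (auto simp: hull_inc sum_divide_distrib[symmetric] t_def)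
    hence "(1 - t / M) *\<^sub>R 0 + (t / M) *\<^sub>R (\<Sum>i\<in>I. (c i / t) *\<^sub>R (M *\<^sub>R f i)) \<in> convex hull S"
      using assms t0 by (intro convexD_alt) (auto simp: t_def hull_inc)
    moreover have "(t / M) *\<^sub>R (\<Sum>i\<in>I. (c i / t) *\<^sub>R (M *\<^sub>R f i)) = (\<Sum>i\<in>I. c i *\<^sub>R f i)"
      using False assms(4) by (simp add: scaleR_sum_right)
    ultimately show ?thesis by simp
  qed
qed

text \<open>Where \<open>h\<close> is small, \<epsilon> suffices. The rest is a compact set on which
  \<open>q\<close> has a positive minimum, so a bound for \<open>h\<close> divided by that minimum
  serves as \<open>C\<close>.\<close>

lemma domination_on_compact:
  fixes h q :: "'a \<Rightarrow> real"
  assumes S: "compactin X S"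
    and h: "continuous_map (subtopology X S) euclideanreal h"
    and q: "continuous_map (subtopology X S) euclideanreal q"
    and q_nonneg: "\<And>v. v \<in> S \<Longrightarrow> 0 \<le> q v"
    and zero: "\<And>v. v \<in> S \<Longrightarrow> q v = 0 \<Longrightarrow> h v = 0"
    and "0 < \<epsilon>"
  obtains C where "0 < C" "\<And>v. v \<in> S \<Longrightarrow> \<bar>h v\<bar> \<le> \<epsilon> + C * q v"
proof -
  define T where "T = {v \<in> S. \<epsilon> \<le> \<bar>h v\<bar>}"
  have top: "topspace (subtopology X S) = S"
    using compactin_subset_topspace[OF S] by auto
  have cS: "compactin (subtopology X S) S" using S by (simp add: compactin_subtopology)
  have habs: "continuous_map (subtopology X S) euclideanreal (\<lambda>v. \<bar>h v\<bar>)"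
    using h by (rule continuous_map_real_abs)
  have "closedin (subtopology X S) {v \<in> topspace (subtopology X S). \<bar>h v\<bar> \<in> {\<epsilon>..}}"
    using habs by (rule closedin_continuous_map_preimage) auto
  hence "compactin (subtopology X S) T"
    using closed_compactin[OF cS] unfolding T_def top by auto
  hence "compact (q ` T)" "compact ((\<lambda>v. \<bar>h v\<bar>) ` S)"
    using image_compactin[OF _ q] image_compactin[OF cS habs]
    by (auto simp flip: compactin_euclidean_iff)
  obtain H where H: "\<And>v. v \<in> S \<Longrightarrow> \<bar>h v\<bar> \<le> H" "0 < H"
  proof -
    obtain H where "\<forall>v\<in>S. \<bar>h v\<bar> \<le> H"
      using compact_imp_bounded[OF \<open>compact ((\<lambda>v. \<bar>h v\<bar>) ` S)\<close>] by (auto simp: bounded_iff)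
    thus ?thesis using that[of "max H 1"] by fastforce
  qed
  \<comment> \<open>If no point has large \<open>h\<close>, any positive \<sigma> will do.\<close>
  obtain \<sigma> where \<sigma>: "0 < \<sigma>" "\<And>v. v \<in> T \<Longrightarrow> \<sigma> \<le> q v"
  proof (cases "T = {}")
    case True thus ?thesis using that[of 1] by simp
  next
    case False
    then obtain v where "v \<in> T" "\<forall>w\<in>T. q v \<le> q w"
      using compact_attains_inf[OF \<open>compact (q ` T)\<close>] by auto
    moreover have "0 < q v"
      using \<open>v \<in> T\<close> q_nonneg[of v] zero[of v] \<open>0 < \<epsilon>\<close> by (force simp: T_def)
    ultimately show ?thesis using that by blast
  qed
  have "\<bar>h v\<bar> \<le> \<epsilon> + (H / \<sigma>) * q v" if "v \<in> S" for v
  proof (cases "v \<in> T")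
    case True
    have "H * \<sigma> \<le> H * q v" using \<sigma>(2)[OF True] H(2) by simp
    hence "H \<le> (H / \<sigma>) * q v" using \<sigma>(1) by (simp add: field_simps)
    thus ?thesis using H(1)[OF that] \<open>0 < \<epsilon>\<close> by linarith
  next
    case False
    moreover have "0 \<le> (H / \<sigma>) * q v" using q_nonneg[OF that] H(2) \<sigma>(1) by simp
    ultimately show ?thesis using that by (auto simp: T_def)
  qed
  thus thesis using that[of "H / \<sigma>"] H(2) \<sigma>(1) by simp
qed

section \<open>Weighted sums and scalar descent\<close>

text \<open>The two conditional summands treat the cases \<open>w\<close> in \<open>A\<close> and
  \<open>w\<close> not in \<open>A\<close> alike. Taking \<open>f\<close> constantly 1 yields the
  total weight.\<close>

lemma sum_insert_split:
  fixes f :: "'v \<Rightarrow> 'a::real_vector"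
  assumes "finite A"
  shows "(\<Sum>v\<in>insert w A. ((if v \<in> A then a v else 0) + (if v = w then b else 0)) *\<^sub>R f v)
    = (\<Sum>v\<in>A. a v *\<^sub>R f v) + b *\<^sub>R f w"
proof -
  have "(\<Sum>v\<in>insert w A. (if v \<in> A then a v else 0) *\<^sub>R f v) = (\<Sum>v\<in>A. a v *\<^sub>R f v)"
    using assms by (intro sum.mono_neutral_cong_right) auto
  moreover have "(\<Sum>v\<in>insert w A. (if v = w then b else 0) *\<^sub>R f v) = b *\<^sub>R f w"
    using assms by (subst sum.mono_neutral_cong_right[of _ "{w}" _ "\<lambda>v. b *\<^sub>R f v"]) auto
  ultimately show ?thesis by (simp add: scaleR_left_distrib sum.distrib)
qed

text \<open>The choice \<open>s = 0\<close> gives monotonicity and hence a limit \<rho>. Passing to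
  the limit for fixed \<open>s\<close> gives \<open>\<rho> \<le> C * s\<close>, and \<open>s\<close>
  may be taken arbitrarily small.\<close>

lemma quadratic_descent_tendsto_zero:
  fixes r :: "nat \<Rightarrow> real"
  assumes nonneg: "\<And>k. 0 \<le> r k" and "0 < C"
    and descent: "\<And>k s. 0 \<le> s \<Longrightarrow> s \<le> 1 \<Longrightarrow> r (Suc k) \<le> r k - s * r k + C * s\<^sup>2"
  shows "r \<longlonglongrightarrow> 0"
proof -
  have "r (Suc k) \<le> r k" for k using descent[of 0 k] by simp
  hence "decseq r" by (rule decseq_SucI)
  moreover have "Bseq r"
    using nonneg \<open>decseq r\<close> by (intro BseqI'[of _ "r 0"]) (auto simp: decseq_def)
  ultimately obtain \<rho> where \<rho>: "r \<longlonglongrightarrow> \<rho>"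
    using Bseq_monoseq_convergent decseq_imp_monoseq convergent_def by blast
  have \<rho>_le: "\<rho> \<le> C * s" if s: "0 < s" "s \<le> 1" for s
  proof -
    have "(\<lambda>k. r k - s * r k + C * s\<^sup>2) \<longlonglongrightarrow> \<rho> - s * \<rho> + C * s\<^sup>2"
      by (intro tendsto_intros \<rho>)
    hence "\<rho> \<le> \<rho> - s * \<rho> + C * s\<^sup>2"
      using LIMSEQ_le[OF LIMSEQ_Suc[OF \<rho>]] descent[of s] s by auto
    hence "s * \<rho> \<le> s * (C * s)" by (simp add: power2_eq_square algebra_simps)
    thus ?thesis using s by simp
  qed
  have "\<rho> \<le> 0"
  proof (rule ccontr)
    assume "\<not> \<rho> \<le> 0"
    define s where "s = min 1 (\<rho> / (2 * C))"
    have s: "0 < s" "s \<le> 1" using \<open>\<not> \<rho> \<le> 0\<close> \<open>0 < C\<close> by (auto simp: s_def)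
    have "C * s \<le> C * (\<rho> / (2 * C))"
      using \<open>0 < C\<close> by (intro mult_left_mono) (auto simp: s_def)
    hence "\<rho> \<le> \<rho> / 2" using \<rho>_le[OF s] \<open>0 < C\<close> by simp
    thus False using \<open>\<not> \<rho> \<le> 0\<close> by simp
  qed
  moreover have "0 \<le> \<rho>" using LIMSEQ_le_const[OF \<rho>] nonneg by blast
  ultimately show ?thesis using \<rho> by simp
qed

text \<open>Cauchy-Schwarz after each weight is split into two square roots.\<close>

lemma weighted_sum_square_le:
  fixes c g :: "'v \<Rightarrow> real"
  assumes "\<And>v. v \<in> S \<Longrightarrow> 0 \<le> c v"
  shows "(\<Sum>v\<in>S. c v * g v)\<^sup>2 \<le> (\<Sum>v\<in>S. c v) * (\<Sum>v\<in>S. c v * (g v)\<^sup>2)"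
proof -
  have "(\<Sum>v\<in>S. sqrt (c v) * (sqrt (c v) * g v))\<^sup>2
    \<le> (\<Sum>v\<in>S. (sqrt (c v))\<^sup>2) * (\<Sum>v\<in>S. (sqrt (c v) * g v)\<^sup>2)"
    by (rule Cauchy_Schwarz_ineq_sum)
  moreover have "sqrt (c v) * (sqrt (c v) * g v) = c v * g v"
    "(sqrt (c v))\<^sup>2 = c v" "(sqrt (c v) * g v)\<^sup>2 = c v * (g v)\<^sup>2" if "v \<in> S" for v
    using assms[OF that] by (simp_all add: power_mult_distrib flip: mult.assoc)
  ultimately show ?thesis by (simp cong: sum.cong)
qed

subsection \<open>Sparse problems with a dual certificate\<close>

text \<open>A setting free of measures and functionals. \<open>X\<close> stands for the closure of
  the extremal points, and \<open>1 + inner (K v) (DF ybar)\<close> is one minus the pairing of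
  \<open>v\<close> with the optimal dual variable, rewritten through the pre-adjoint. Continuity of
  \<open>K\<close> is required only against fixed vectors, norm compactness of its image
  separately.\<close>

locale sparse_problem =
  fixes F :: "'y::{real_inner,complete_space} \<Rightarrow> real" and DF :: "'y \<Rightarrow> 'y"
    and K :: "'v \<Rightarrow> 'y" and X :: "'v topology"
    and I :: "'i set" and u :: "'i \<Rightarrow> 'v" and lam :: "'i \<Rightarrow> real" and ybar :: 'y
  assumes F_gderiv: "\<And>y. GDERIV F y :> DF y"
    and F_tangent: "\<And>y z. F y + inner (DF y) (z - y) \<le> F z"
    and F_tangent_strict: "\<And>y z. z \<noteq> y \<Longrightarrow> F y + inner (DF y) (z - y) < F z"
    and X_compact: "compact_space X"
    and K_continuous: "\<And>y. continuous_map X euclideanreal (\<lambda>v. inner (K v) y)"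
    and K_compact: "compact (K ` topspace X)"
    and I_finite: "finite I" and I_nonempty: "I \<noteq> {}"
    and u_in: "\<And>i. i \<in> I \<Longrightarrow> u i \<in> topspace X"
    and u_inj: "inj_on u I"
    and Ku_inj: "inj_on (\<lambda>i. K (u i)) I" and Ku_indep: "independent ((\<lambda>i. K (u i)) ` I)"
    and lam_pos: "\<And>i. i \<in> I \<Longrightarrow> 0 < lam i"
    and ybar_eq: "ybar = (\<Sum>i\<in>I. lam i *\<^sub>R K (u i))"
    and certificate_nonneg: "\<And>v. v \<in> topspace X \<Longrightarrow> 0 \<le> 1 + inner (K v) (DF ybar)"
    and certificate_zero: "\<And>v. v \<in> topspace X \<Longrightarrow> 1 + inner (K v) (DF ybar) = 0 \<longleftrightarrow> v \<in> u ` I"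
begin

definition q :: "'v \<Rightarrow> real" where "q v = 1 + inner (K v) (DF ybar)"

definition bregman :: "'y \<Rightarrow> real" where
  "bregman y = F y - F ybar - inner (DF ybar) (y - ybar)"

definition weight :: real where "weight = sum lam I"

definition Jbar :: real where "Jbar = F ybar + weight"

lemma q_nonneg: "v \<in> topspace X \<Longrightarrow> 0 \<le> q v"
  using certificate_nonneg by (simp add: q_def)

lemma q_zero: "v \<in> topspace X \<Longrightarrow> q v = 0 \<longleftrightarrow> v \<in> u ` I"
  using certificate_zero by (simp add: q_def)

lemma q_continuous: "continuous_map X euclideanreal q"
  unfolding q_def by (intro continuous_intros K_continuous)

lemma weight_pos: "0 < weight"
  unfolding weight_def using I_finite I_nonempty lam_pos by (intro sum_pos) auto

lemma bregman_nonneg: "0 \<le> bregman y"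
  using F_tangent[of ybar y] by (simp add: bregman_def)

lemma bregman_zero: "bregman y = 0 \<longleftrightarrow> y = ybar"
  using F_tangent_strict[of y ybar] by (cases "y = ybar") (auto simp: bregman_def)

lemma inner_ybar: "inner ybar (DF ybar) = - weight"
proof -
  have "lam i * inner (K (u i)) (DF ybar) = - lam i" if "i \<in> I" for i
  proof -
    have "1 + inner (K (u i)) (DF ybar) = 0" using certificate_zero u_in that by blast
    hence "inner (K (u i)) (DF ybar) = - 1" by linarith
    thus ?thesis by simp
  qed
  hence "(\<Sum>i\<in>I. lam i * inner (K (u i)) (DF ybar)) = - weight"
    by (simp add: weight_def sum_negf)
  moreover have "inner ybar (DF ybar) = (\<Sum>i\<in>I. lam i * inner (K (u i)) (DF ybar))"
    by (subst (1) ybar_eq) (simp add: inner_sum_left)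
  ultimately show ?thesis by simp
qed

text \<open>For a measure of mass \<open>m\<close> with observation \<open>y\<close>, the last
  bracket is the integral of \<open>q\<close>. By \<open>inner_ybar\<close> the linear term at
  \<open>ybar\<close> cancels against \<open>weight\<close>.\<close>

lemma excess_eq: "F y + m - Jbar = bregman y + (m + inner y (DF ybar))"
  using inner_ybar
  by (simp add: bregman_def Jbar_def inner_diff_right inner_commute)

lemma sum_q: "(\<Sum>v\<in>S. c v * q v) = sum c S + inner (\<Sum>v\<in>S. c v *\<^sub>R K v) (DF ybar)"
  by (simp add: q_def inner_sum_left algebra_simps sum.distrib)

lemma K_bounded:
  obtains R where "0 < R" "\<And>v. v \<in> topspace X \<Longrightarrow> norm (K v) \<le> R"
  using compact_imp_bounded[OF K_compact] by (auto simp: bounded_pos)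

text \<open>Testing an observation with \<open>w i\<close> reads off the weight at
  \<open>u i\<close>; this serves uniqueness, weak* convergence and the local mass bound.\<close>

lemma dual_vectors:
  obtains w where
    "\<And>i j. i \<in> I \<Longrightarrow> j \<in> I \<Longrightarrow> inner (w i) (K (u j)) = (if i = j then 1 else 0)"
  using dual_family[OF I_finite Ku_inj Ku_indep] by blast

lemma inner_dual_sum:
  assumes w: "\<And>i j. i \<in> I \<Longrightarrow> j \<in> I \<Longrightarrow> inner (w i) (K (u j)) = (if i = j then 1 else 0)"
    and "i \<in> I"
  shows "inner (w i) (\<Sum>j\<in>I. a j *\<^sub>R K (u j)) = a i"
proof -
  have "inner (w i) (\<Sum>j\<in>I. a j *\<^sub>R K (u j)) = (\<Sum>j\<in>I. if i = j then a j else 0)"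
    unfolding inner_sum_right using w[OF \<open>i \<in> I\<close>] by (intro sum.cong) auto
  thus ?thesis using I_finite \<open>i \<in> I\<close> by simp
qed

lemma inner_dual_ybar:
  assumes "\<And>i j. i \<in> I \<Longrightarrow> j \<in> I \<Longrightarrow> inner (w i) (K (u j)) = (if i = j then 1 else 0)"
    and "i \<in> I"
  shows "inner (w i) ybar = lam i"
  using inner_dual_sum[OF assms, of lam] by (simp flip: ybar_eq)

text \<open>Since \<open>q\<close> vanishes only at the points \<open>u i\<close>, it suffices that
  \<open>h\<close> vanishes at those of them that lie in \<open>S\<close>.\<close>

lemma domination:
  fixes h :: "'v \<Rightarrow> real"
  assumes S: "closedin X S" and h: "continuous_map X euclideanreal h"
    and zero: "\<And>v. v \<in> S \<Longrightarrow> v \<in> u ` I \<Longrightarrow> h v = 0" and "0 < \<epsilon>"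
  obtains C where "0 < C" "\<And>v. v \<in> S \<Longrightarrow> \<bar>h v\<bar> \<le> \<epsilon> + C * q v"
proof -
  have sub: "S \<subseteq> topspace X" using S by (rule closedin_subset)
  have "compactin X S" using X_compact S by (rule closedin_compact_space)
  moreover have "0 \<le> q v" "q v = 0 \<Longrightarrow> h v = 0" if "v \<in> S" for v
    using that sub q_nonneg q_zero zero by blast+
  ultimately obtain C where "0 < C" "\<And>v. v \<in> S \<Longrightarrow> \<bar>h v\<bar> \<le> \<epsilon> + C * q v"
    using domination_on_compact[of X S h q \<epsilon>] \<open>0 < \<epsilon>\<close> h q_continuous
      continuous_map_from_subtopology by blast
  thus thesis by (rule that)
qed

end

subsection \<open>Convergence of the iteration\<close>

text \<open>The iterates are represented by positive weights \<open>c k\<close> on finite sets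
  \<open>A k\<close>. \<open>vhat_max\<close> is a minimality statement because the dual variable
  carries a minus sign. \<open>optimal\<close> states optimality on the own support,
  \<open>optimal_Suc\<close> that of the next iterate on the enlarged set.\<close>

locale sparse_iteration = sparse_problem F DF K X I u lam ybar
  for F :: "'y::{real_inner,complete_space} \<Rightarrow> real" and DF and K :: "'v \<Rightarrow> 'y" and X
    and I :: "'i set" and u lam ybar +
  fixes E :: "'v set" and A :: "nat \<Rightarrow> 'v set" and c :: "nat \<Rightarrow> 'v \<Rightarrow> real"
    and vhat :: "nat \<Rightarrow> 'v"
  assumes F_bdd: "bdd_below (range F)"
    and DF_lipschitz: "\<And>S. compact S \<Longrightarrow> \<exists>L. L-lipschitz_on S DF"
    and E_sub: "E \<subseteq> topspace X" and u_E: "\<And>i. i \<in> I \<Longrightarrow> u i \<in> E"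
    and A_finite: "\<And>k. finite (A k)" and A_E: "\<And>k. A k \<subseteq> E"
    and c_pos: "\<And>k v. v \<in> A k \<Longrightarrow> 0 < c k v"
    and vhat_E: "\<And>k. vhat k \<in> E"
    and vhat_max: "\<And>k v. v \<in> E \<Longrightarrow>
      inner (K (vhat k)) (DF (\<Sum>v\<in>A k. c k v *\<^sub>R K v)) \<le> inner (K v) (DF (\<Sum>v\<in>A k. c k v *\<^sub>R K v))"
    and optimal: "\<And>k e. (\<And>v. v \<in> A k \<Longrightarrow> 0 \<le> e v) \<Longrightarrow>
      F (\<Sum>v\<in>A k. c k v *\<^sub>R K v) + sum (c k) (A k) \<le> F (\<Sum>v\<in>A k. e v *\<^sub>R K v) + sum e (A k)"
    and optimal_Suc: "\<And>k e. (\<And>v. v \<in> insert (vhat k) (A k) \<Longrightarrow> 0 \<le> e v) \<Longrightarrow>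
      F (\<Sum>v\<in>A (Suc k). c (Suc k) v *\<^sub>R K v) + sum (c (Suc k)) (A (Suc k))
        \<le> F (\<Sum>v\<in>insert (vhat k) (A k). e v *\<^sub>R K v) + sum e (insert (vhat k) (A k))"
begin

definition y :: "nat \<Rightarrow> 'y" where "y k = (\<Sum>v\<in>A k. c k v *\<^sub>R K v)"

definition mass :: "nat \<Rightarrow> real" where "mass k = sum (c k) (A k)"

definition r :: "nat \<Rightarrow> real" where "r k = F (y k) + mass k - Jbar"

text \<open>This is the violation \<open>P k (vhat k) - 1\<close> of the dual constraint.\<close>

definition gap :: "nat \<Rightarrow> real" where "gap k = - inner (K (vhat k)) (DF (y k)) - 1"

lemma A_sub: "v \<in> A k \<Longrightarrow> v \<in> topspace X"
  using A_E E_sub by blast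

lemma r_eq: "r k = bregman (y k) + (\<Sum>v\<in>A k. c k v * q v)"
  unfolding r_def sum_q using excess_eq[of "y k" "mass k"] by (simp add: mass_def y_def)

lemma sum_q_nonneg: "0 \<le> (\<Sum>v\<in>A k. c k v * q v)"
  using c_pos q_nonneg A_sub by (intro sum_nonneg mult_nonneg_nonneg) (auto intro: less_imp_le)

lemma r_nonneg: "0 \<le> r k"
  using r_eq bregman_nonneg sum_q_nonneg by simp

lemma sum_q_le_r: "(\<Sum>v\<in>A k. c k v * q v) \<le> r k"
  using r_eq[of k] bregman_nonneg[of "y k"] by simp

lemma bregman_le_r: "bregman (y k) \<le> r k"
  using r_eq[of k] sum_q_nonneg[of k] by simp

text \<open>Moving the weight of a single active atom in either direction does not decrease the
  objective.\<close>

lemma stationary: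
  assumes v: "v \<in> A k"
  shows "inner (K v) (DF (y k)) = - 1"
proof -
  define \<phi> where "\<phi> t = F (y k + t *\<^sub>R K v) + t" for t
  have "(\<phi> has_real_derivative inner (K v) (DF (y k)) + 1) (at 0)"
    unfolding \<phi>_def using F_gderiv[of "y k"]
    by (intro derivative_intros GDERIV_along_line) simp
  \<comment> \<open>For \<open>t\<close> smaller than \<open>c k v\<close> in modulus the perturbed
    weights stay nonnegative, so 0 is an interior local minimum of \<open>\<phi>\<close>.\<close>
  moreover have "\<phi> 0 \<le> \<phi> t" if t: "\<bar>0 - t\<bar> < c k v" for t
  proof -
    define e where "e w = c k w + (if w = v then t else 0)" for w
    have "0 \<le> e w" if "w \<in> A k" for w
      using t c_pos[OF that] by (auto simp: e_def)
    from optimal[of k e, OF this]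
    have "F (y k) + mass k \<le> F (\<Sum>w\<in>A k. e w *\<^sub>R K w) + sum e (A k)" by (simp add: y_def mass_def)
    moreover have "(\<Sum>w\<in>A k. (if w = v then t else 0) *\<^sub>R K w) = t *\<^sub>R K v"
      using v A_finite by (subst sum.mono_neutral_cong_right[of _ "{v}" _ "\<lambda>w. t *\<^sub>R K w"]) auto
    hence "(\<Sum>w\<in>A k. e w *\<^sub>R K w) = y k + t *\<^sub>R K v"
      by (simp add: e_def scaleR_left_distrib sum.distrib y_def)
    moreover have "sum e (A k) = mass k + t"
      using v A_finite by (simp add: e_def sum.distrib mass_def)
    ultimately show ?thesis by (simp add: \<phi>_def)
  qed
  ultimately have "inner (K v) (DF (y k)) + 1 = 0"
    using c_pos[OF v] by (intro DERIV_local_min[of \<phi> _ 0 "c k v"]) auto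
  thus ?thesis by simp
qed

lemma descend:
  assumes "\<And>v. v \<in> A k \<Longrightarrow> 0 \<le> a v" "0 \<le> b"
  shows "F (y (Suc k)) + mass (Suc k)
    \<le> F ((\<Sum>v\<in>A k. a v *\<^sub>R K v) + b *\<^sub>R K (vhat k)) + (sum a (A k) + b)"
proof -
  define e where "e v = (if v \<in> A k then a v else 0) + (if v = vhat k then b else 0)" for v
  have "F (y (Suc k)) + mass (Suc k)
    \<le> F (\<Sum>v\<in>insert (vhat k) (A k). e v *\<^sub>R K v) + sum e (insert (vhat k) (A k))"
    unfolding y_def mass_def using assms by (intro optimal_Suc) (auto simp: e_def)
  moreover have "(\<Sum>v\<in>insert (vhat k) (A k). e v *\<^sub>R K v)
      = (\<Sum>v\<in>A k. a v *\<^sub>R K v) + b *\<^sub>R K (vhat k)"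
    unfolding e_def by (rule sum_insert_split[OF A_finite])
  moreover have "sum e (insert (vhat k) (A k)) = sum a (A k) + b"
    using sum_insert_split[OF A_finite, where w="vhat k" and a=a and b=b and f="\<lambda>_. 1 :: real"] by (simp add: e_def)
  ultimately show ?thesis by simp
qed

lemma r_Suc_le: "r (Suc k) \<le> r k"
  using descend[of k "c k" 0] c_pos by (simp add: r_def y_def mass_def less_imp_le)

lemma r_le_r0: "r k \<le> r 0"
  by (induction k) (use r_Suc_le order.trans in blast)+

section \<open>Mass bound and the compact region of observations\<close>

text \<open>The second entry bounds all masses, as the residuals decrease and \<open>F\<close> is
  bounded below; the first one ensures that \<open>ybar\<close> also belongs to
  \<open>region\<close>.\<close>

definition mass_bound :: real where
  "mass_bound = max weight (r 0 + Jbar - Inf (range F))"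

lemma mass_le: "mass k \<le> mass_bound"
proof -
  have "Inf (range F) \<le> F (y k)" using F_bdd by (simp add: cInf_lower)
  thus ?thesis using r_le_r0[of k] by (simp add: mass_bound_def r_def)
qed

lemma weight_le: "weight \<le> mass_bound" by (simp add: mass_bound_def)

lemma mass_bound_pos: "0 < mass_bound" using weight_pos weight_le by linarith

text \<open>A compact convex set containing the observations of all finite sums of atoms with mass
  at most \<open>mass_bound\<close>; on it one Lipschitz constant of the gradient is
  available.\<close>

definition region :: "'y set" where
  "region = closure (convex hull (insert 0 ((\<lambda>v. mass_bound *\<^sub>R K v) ` topspace X)))"

lemma region_compact: "compact region"
proof -
  have "compact (insert 0 ((\<lambda>z. mass_bound *\<^sub>R z) ` K ` topspace X))"
    using K_compact compact_scaling compact_insert by blast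
  thus ?thesis unfolding region_def image_image by (rule compact_closure_convex_hull)
qed

lemma sum_in_region:
  assumes "finite S" "\<And>i. i \<in> S \<Longrightarrow> 0 \<le> e i" "\<And>i. i \<in> S \<Longrightarrow> p i \<in> topspace X"
    "sum e S \<le> mass_bound"
  shows "(\<Sum>i\<in>S. e i *\<^sub>R K (p i)) \<in> region"
  unfolding region_def using assms mass_bound_pos
  by (intro closure_subset[THEN subsetD] weighted_sum_in_convex_hull[where M=mass_bound]) auto

lemma y_region: "y k \<in> region"
  unfolding y_def using A_finite c_pos A_sub mass_le
  by (intro sum_in_region) (auto simp: less_imp_le mass_def)

lemma ybar_region: "ybar \<in> region"
proof -
  have "(\<Sum>i\<in>I. lam i *\<^sub>R K (u i)) \<in> region"
    using I_finite lam_pos u_in weight_le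
    by (intro sum_in_region) (auto simp: less_imp_le weight_def)
  thus ?thesis unfolding ybar_eq[symmetric] .
qed

lemma DF_lipschitz_region:
  obtains L where "0 < L"
    "\<And>a b. a \<in> region \<Longrightarrow> b \<in> region \<Longrightarrow> norm (DF a - DF b) \<le> L * norm (a - b)"
proof -
  obtain L where L: "L-lipschitz_on region DF" using DF_lipschitz[OF region_compact] by blast
  \<comment> \<open>Adding 1 makes the constant positive, since \<open>L\<close> may be 0.\<close>
  have "norm (DF a - DF b) \<le> (L + 1) * norm (a - b)" if "a \<in> region" "b \<in> region" for a b
  proof -
    have "norm (DF a - DF b) \<le> L * norm (a - b)"
      using lipschitz_onD[OF L that] by (simp add: dist_norm)
    also have "\<dots> \<le> (L + 1) * norm (a - b)" by (intro mult_right_mono) auto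
    finally show ?thesis .
  qed
  thus thesis using that[of "L + 1"] lipschitz_on_nonneg[OF L] by simp
qed

section \<open>Descent of the residual\<close>

text \<open>The tangent inequality at \<open>y k\<close> is evaluated at \<open>ybar\<close>.
  Stationarity turns the pairing of \<open>y k\<close> with the gradient into minus the mass, and
  \<open>vhat k\<close> does at least as well as every \<open>u i\<close>.\<close>

lemma r_le_gap: "r k \<le> weight * gap k"
proof -
  have "F (y k) + inner (DF (y k)) (ybar - y k) \<le> F ybar" by (rule F_tangent)
  moreover have "inner (y k) (DF (y k)) = - mass k"
    by (subst (1) y_def) (simp add: inner_sum_left stationary mass_def sum_negf)
  ultimately have "r k \<le> - inner ybar (DF (y k)) - weight"
    by (simp add: r_def Jbar_def inner_diff_right inner_commute)
  also have "\<dots> = (\<Sum>i\<in>I. lam i * (- inner (K (u i)) (DF (y k)) - 1))"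
    by (subst ybar_eq) (simp add: inner_sum_left weight_def right_diff_distrib sum_subtractf sum_negf)
  also have "\<dots> \<le> (\<Sum>i\<in>I. lam i * gap k)"
    unfolding gap_def y_def using vhat_max u_E lam_pos
    by (intro sum_mono mult_left_mono) (auto intro: less_imp_le)
  also have "\<dots> = weight * gap k" by (simp add: weight_def sum_distrib_right)
  finally show ?thesis .
qed

lemma gap_nonneg: "0 \<le> gap k"
proof -
  have "0 \<le> weight * gap k" using r_le_gap[of k] r_nonneg[of k] by linarith
  thus ?thesis using weight_pos by (simp add: zero_le_mult_iff)
qed

text \<open>Part \<open>e\<close> of the current weights is replaced by an atom of weight \<open>t\<close> at the new point.\<close>

lemma transfer_descent:
  assumes L: "\<And>a b. a \<in> region \<Longrightarrow> b \<in> region \<Longrightarrow> norm (DF a - DF b) \<le> L * norm (a - b)"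
    and e: "\<And>v. v \<in> A k \<Longrightarrow> 0 \<le> e v" "\<And>v. v \<in> A k \<Longrightarrow> e v \<le> c k v"
    and t: "0 \<le> t" and s: "0 \<le> s" "s \<le> 1"
    and mass: "mass k + s * (t - sum e (A k)) \<le> mass_bound"
  shows "r (Suc k) \<le> r k - s * (t / weight) * r k
    + L * s\<^sup>2 * (norm (t *\<^sub>R K (vhat k) - (\<Sum>v\<in>A k. e v *\<^sub>R K v)))\<^sup>2"
proof -
  define a where "a v = c k v - s * e v" for v
  define \<delta> where "\<delta> = t *\<^sub>R K (vhat k) - (\<Sum>v\<in>A k. e v *\<^sub>R K v)"
  define z where "z = y k + s *\<^sub>R \<delta>"
  have a: "0 \<le> a v" if "v \<in> A k" for v
  proof -
    have "s * e v \<le> 1 * e v" using s e[OF that] by (intro mult_right_mono) auto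
    thus ?thesis using e[OF that] by (simp add: a_def)
  qed
  have st: "0 \<le> s * t" using s t by simp
  have z_eq: "(\<Sum>v\<in>A k. a v *\<^sub>R K v) + (s * t) *\<^sub>R K (vhat k) = z"
    by (simp add: a_def z_def \<delta>_def y_def scaleR_left_diff_distrib scaleR_right_diff_distrib
        sum_subtractf scaleR_sum_right)
  have m_eq: "sum a (A k) + s * t = mass k + s * (t - sum e (A k))"
  proof -
    have "sum a (A k) = (\<Sum>v\<in>A k. c k v - s * e v)" by (simp add: a_def)
    also have "\<dots> = mass k - s * sum e (A k)"
      by (simp add: mass_def sum_subtractf sum_distrib_left)
    finally show ?thesis by (simp add: right_diff_distrib)
  qed
  \<comment> \<open>The trial observation must stay in \<open>region\<close>, where the Lipschitz
    bound holds; this is what the hypothesis on the mass is for.\<close>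
  have "z \<in> region"
  proof -
    define f where "f v = (if v \<in> A k then a v else 0) + (if v = vhat k then s * t else 0)" for v
    have "(\<Sum>v\<in>insert (vhat k) (A k). f v *\<^sub>R K v) = z"
      using sum_insert_split[OF A_finite, where w="vhat k" and a=a and b="s * t" and f=K] z_eq
      by (simp add: f_def)
    moreover have "sum f (insert (vhat k) (A k)) = sum a (A k) + s * t"
      using sum_insert_split[OF A_finite, where w="vhat k" and a=a and b="s * t" and f="\<lambda>_. 1 :: real"]
      by (simp add: f_def)
    hence "(\<Sum>v\<in>insert (vhat k) (A k). f v *\<^sub>R K v) \<in> region"
      using m_eq mass a st A_finite A_sub vhat_E E_sub
      by (intro sum_in_region) (auto simp: f_def)
    ultimately show ?thesis by simp
  qed
  have "inner (\<Sum>v\<in>A k. e v *\<^sub>R K v) (DF (y k)) = - sum e (A k)"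
    by (simp add: inner_sum_left stationary sum_negf)
  \<comment> \<open>Once the change of mass is added, the terms \<open>sum e (A k)\<close> and
    \<open>t\<close> cancel and only \<open>- s * t * gap k\<close> remains.\<close>
  hence lin: "inner (DF (y k)) (s *\<^sub>R \<delta>) = s * (sum e (A k) - t * (gap k + 1))"
    by (simp add: \<delta>_def gap_def inner_diff_right inner_commute)
  \<comment> \<open>The tangent is taken at \<open>z\<close> and evaluated at \<open>y k\<close>,
    which bounds \<open>F z\<close> from above; the Lipschitz bound then replaces the gradient at
    \<open>z\<close> by that at \<open>y k\<close>.\<close>
  have "F z \<le> F (y k) + inner (DF z) (s *\<^sub>R \<delta>)"
    using F_tangent[of z "y k"] by (simp add: z_def)
  also have "inner (DF z) (s *\<^sub>R \<delta>) = inner (DF (y k)) (s *\<^sub>R \<delta>) + inner (DF z - DF (y k)) (s *\<^sub>R \<delta>)"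
    by (simp only: inner_diff_left)
  also have "inner (DF z - DF (y k)) (s *\<^sub>R \<delta>) \<le> norm (DF z - DF (y k)) * norm (s *\<^sub>R \<delta>)"
    by (rule norm_cauchy_schwarz)
  also have "\<dots> \<le> L * norm (s *\<^sub>R \<delta>) * norm (s *\<^sub>R \<delta>)"
    using L[OF \<open>z \<in> region\<close> y_region[of k]] by (intro mult_right_mono) (auto simp: z_def)
  also have "\<dots> = L * s\<^sup>2 * (norm \<delta>)\<^sup>2" by (simp add: power2_eq_square algebra_simps)
  finally have Fz: "F z \<le> F (y k) + (s * (sum e (A k) - t * (gap k + 1)) + L * s\<^sup>2 * (norm \<delta>)\<^sup>2)"
    unfolding lin by simp
  have "F (y (Suc k)) + mass (Suc k) \<le> F z + (mass k + s * (t - sum e (A k)))"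
    using descend[of k a "s * t", OF a st] z_eq m_eq by simp
  hence "r (Suc k) \<le> r k - s * t * gap k + L * s\<^sup>2 * (norm \<delta>)\<^sup>2"
    using Fz by (simp add: r_def algebra_simps)
  moreover have "s * (t / weight) * r k \<le> s * (t / weight) * (weight * gap k)"
    using r_le_gap[of k] s t weight_pos by (intro mult_left_mono) auto
  moreover have "s * (t / weight) * (weight * gap k) = s * t * gap k" using weight_pos by simp
  ultimately show ?thesis unfolding \<delta>_def by linarith
qed

text \<open>All the mass is moved: \<open>e\<close> is \<open>c k\<close> and \<open>t\<close> is
  \<open>weight\<close>, so the linear term is exactly \<open>s * r k\<close>, while the
  displacement is bounded by \<open>B\<close>.\<close>

lemma r_tendsto_zero: "r \<longlonglongrightarrow> 0"
proof -
  obtain L where L: "0 < L"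
    "\<And>a b. a \<in> region \<Longrightarrow> b \<in> region \<Longrightarrow> norm (DF a - DF b) \<le> L * norm (a - b)"
    using DF_lipschitz_region by blast
  obtain R where R: "0 < R" "\<And>v. v \<in> topspace X \<Longrightarrow> norm (K v) \<le> R" using K_bounded by blast
  define B where "B = 2 * mass_bound * R"
  have "0 < B" using mass_bound_pos R(1) by (simp add: B_def)
  show ?thesis
  proof (rule quadratic_descent_tendsto_zero[OF r_nonneg, of "L * B\<^sup>2"])
    show "0 < L * B\<^sup>2" using L(1) \<open>0 < B\<close> by simp
    fix k and s :: real assume s: "0 \<le> s" "s \<le> 1"
    have "norm (y k) \<le> (\<Sum>v\<in>A k. c k v * R)"
      unfolding y_def using R(2) A_sub c_pos
      by (intro order.trans[OF norm_sum] sum_mono) (auto simp: less_imp_le intro!: mult_left_mono)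
    also have "\<dots> = mass k * R" by (simp add: mass_def sum_distrib_right)
    also have "\<dots> \<le> mass_bound * R" using mass_le R(1) by simp
    finally have "norm (y k) \<le> mass_bound * R" .
    moreover have "norm (weight *\<^sub>R K (vhat k)) \<le> mass_bound * R"
      using weight_pos weight_le R(1) R(2)[of "vhat k"] vhat_E[of k] E_sub
      by (auto intro!: mult_mono)
    ultimately have "norm (weight *\<^sub>R K (vhat k) - y k) \<le> B"
      unfolding B_def using norm_triangle_ineq4[of "weight *\<^sub>R K (vhat k)" "y k"] by linarith
    hence "(norm (weight *\<^sub>R K (vhat k) - y k))\<^sup>2 \<le> B\<^sup>2" by (intro power_mono) auto
    hence "L * s\<^sup>2 * (norm (weight *\<^sub>R K (vhat k) - y k))\<^sup>2 \<le> L * s\<^sup>2 * B\<^sup>2"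
      using L(1) by (intro mult_left_mono) auto
    \<comment> \<open>The new mass is a convex combination of \<open>mass k\<close> and
      \<open>weight\<close>.\<close>
    moreover have "mass k + s * (weight - sum (c k) (A k)) \<le> mass_bound"
    proof -
      have "(1 - s) * mass k + s * weight \<le> (1 - s) * mass_bound + s * mass_bound"
        using s mass_le weight_le by (intro add_mono mult_left_mono) auto
      thus ?thesis by (simp add: mass_def algebra_simps)
    qed
    ultimately show "r (Suc k) \<le> r k - s * r k + L * B\<^sup>2 * s\<^sup>2"
      using transfer_descent[OF L(2), of k "c k" weight s] c_pos weight_pos s
      by (simp add: y_def less_imp_le mult.commute mult.left_commute)
  qed
qed

section \<open>Convergence of the observations and of the measures\<close>

text \<open>By strict convexity the Bregman distance vanishes only at \<open>ybar\<close>, so on the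
  compact \<open>region\<close> it dominates the norm distance up to \<epsilon>; it is itself at
  most the residual.\<close>

lemma y_tendsto: "y \<longlonglongrightarrow> ybar"
proof (rule metric_LIMSEQ_I)
  fix \<epsilon> :: real assume "0 < \<epsilon>"
  have F_cont: "continuous_on UNIV F"
    using F_gderiv has_derivative_continuous unfolding gderiv_def
    by (intro continuous_at_imp_continuous_on) blast
  have "continuous_on region (\<lambda>z. norm (z - ybar))" "continuous_on region bregman"
    unfolding bregman_def by (intro continuous_intros continuous_on_subset[OF F_cont]; simp)+
  then obtain C where C: "0 < C" "\<And>z. z \<in> region \<Longrightarrow> \<bar>norm (z - ybar)\<bar> \<le> \<epsilon>/2 + C * bregman z"
    using domination_on_compact[of euclidean region "\<lambda>z. norm (z - ybar)" bregman "\<epsilon>/2"]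
      region_compact bregman_nonneg bregman_zero \<open>0 < \<epsilon>\<close>
    by (auto simp: continuous_map_iff_continuous)
  obtain k0 where k0: "\<And>k. k0 \<le> k \<Longrightarrow> r k < \<epsilon> / (2 * C)"
    using order_tendstoD(2)[OF r_tendsto_zero, of "\<epsilon> / (2 * C)"] \<open>0 < \<epsilon>\<close> C(1)
    by (auto simp: eventually_sequentially)
  have "dist (y k) ybar < \<epsilon>" if "k0 \<le> k" for k
  proof -
    have "C * bregman (y k) \<le> C * r k" using bregman_le_r C(1) by simp
    also have "\<dots> < \<epsilon> / 2" using k0[OF that] C(1) by (simp add: field_simps)
    finally show ?thesis using C(2)[OF y_region[of k]] by (simp add: dist_norm)
  qed
  thus "\<exists>k0. \<forall>k\<ge>k0. dist (y k) ybar < \<epsilon>" by blast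
qed

text \<open>The pointwise bound is summed against the weights: the mass is bounded, and the integral
  of \<open>q\<close> is at most the residual.\<close>

lemma dominated_sum_le:
  assumes "\<And>v. v \<in> S \<Longrightarrow> \<bar>h v\<bar> \<le> \<epsilon> + C * q v" "S \<subseteq> A k" "0 \<le> \<epsilon>" "0 \<le> C"
  shows "\<bar>\<Sum>v\<in>S. c k v * h v\<bar> \<le> \<epsilon> * mass_bound + C * r k"
proof -
  have "\<bar>\<Sum>v\<in>S. c k v * h v\<bar> \<le> (\<Sum>v\<in>S. \<bar>c k v * h v\<bar>)" by (rule sum_abs)
  also have "\<dots> \<le> (\<Sum>v\<in>S. c k v * (\<epsilon> + C * q v))"
  proof (rule sum_mono)
    fix v assume "v \<in> S"
    hence "0 < c k v" "\<bar>h v\<bar> \<le> \<epsilon> + C * q v" using assms c_pos by blast+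
    thus "\<bar>c k v * h v\<bar> \<le> c k v * (\<epsilon> + C * q v)" by (simp add: abs_mult)
  qed
  also have "\<dots> \<le> (\<Sum>v\<in>A k. c k v * (\<epsilon> + C * q v))"
    using assms A_finite c_pos q_nonneg A_sub
    by (intro sum_mono2 mult_nonneg_nonneg add_nonneg_nonneg) (auto intro: less_imp_le)
  also have "\<dots> = \<epsilon> * mass k + C * (\<Sum>v\<in>A k. c k v * q v)"
    by (simp add: mass_def sum_distrib_left distrib_left sum.distrib mult.left_commute mult.commute)
  also have "\<dots> \<le> \<epsilon> * mass_bound + C * r k"
    using assms mass_le sum_q_le_r by (intro add_mono mult_left_mono) auto
  finally show ?thesis .
qed

text \<open>Subtracting a combination of the functions \<open>v \<mapsto> (w\<^sub>i, K v)\<close>, whose integrals converge because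
  \<open>y k\<close> does, reduces the claim to functions that vanish at all \<open>u i\<close>.\<close>

lemma weak_convergence:
  fixes f :: "'v \<Rightarrow> real"
  assumes f: "continuous_map X euclideanreal f"
  shows "(\<lambda>k. \<Sum>v\<in>A k. c k v * f v) \<longlonglongrightarrow> (\<Sum>i\<in>I. lam i * f (u i))"
proof -
  obtain w where w: "\<And>i j. i \<in> I \<Longrightarrow> j \<in> I \<Longrightarrow> inner (w i) (K (u j)) = (if i = j then 1 else 0)"
    using dual_vectors by blast
  \<comment> \<open>The function \<open>inner (K v) z\<close> takes the value \<open>f (u i)\<close>
    at each \<open>u i\<close>, so the remainder \<open>h\<close> vanishes there.\<close>
  define z where "z = (\<Sum>i\<in>I. f (u i) *\<^sub>R w i)"
  define h where "h v = f v - inner (K v) z" for v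
  have h: "continuous_map X euclideanreal h"
    unfolding h_def by (intro continuous_intros f K_continuous)
  have h0: "h v = 0" if v: "v \<in> u ` I" for v
  proof -
    obtain j where j: "j \<in> I" "v = u j" using v by blast
    have "inner (K (u j)) z = (\<Sum>i\<in>I. f (u i) * inner (w i) (K (u j)))"
      by (simp add: z_def inner_sum_right inner_commute)
    also have "\<dots> = (\<Sum>i\<in>I. if i = j then f (u i) else 0)"
      using w j(1) by (intro sum.cong) auto
    finally show ?thesis using I_finite j by (simp add: h_def)
  qed
  have "(\<lambda>k. \<Sum>v\<in>A k. c k v * h v) \<longlonglongrightarrow> 0"
  proof (rule LIMSEQ_I)
    fix \<epsilon> :: real assume "0 < \<epsilon>"
    define \<epsilon>' where "\<epsilon>' = \<epsilon> / (2 * mass_bound)"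
    have \<epsilon>': "0 < \<epsilon>'" "\<epsilon>' * mass_bound = \<epsilon> / 2"
      using \<open>0 < \<epsilon>\<close> mass_bound_pos by (auto simp: \<epsilon>'_def)
    obtain C where C: "0 < C" "\<And>v. v \<in> topspace X \<Longrightarrow> \<bar>h v\<bar> \<le> \<epsilon>' + C * q v"
      using domination[of "topspace X" h \<epsilon>'] h h0 \<epsilon>'(1) by auto
    obtain k0 where k0: "\<And>k. k0 \<le> k \<Longrightarrow> r k < \<epsilon> / (2 * C)"
      using order_tendstoD(2)[OF r_tendsto_zero, of "\<epsilon> / (2 * C)"] \<open>0 < \<epsilon>\<close> C(1)
      by (auto simp: eventually_sequentially)
    have "\<bar>\<Sum>v\<in>A k. c k v * h v\<bar> < \<epsilon>" if "k0 \<le> k" for k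
    proof -
      have "C * r k < \<epsilon> / 2" using k0[OF that] C(1) by (simp add: field_simps)
      moreover have "\<bar>\<Sum>v\<in>A k. c k v * h v\<bar> \<le> \<epsilon>' * mass_bound + C * r k"
        using C A_sub \<epsilon>' by (intro dominated_sum_le) auto
      ultimately show ?thesis using \<epsilon>'(2) by linarith
    qed
    thus "\<exists>k0. \<forall>k\<ge>k0. norm ((\<Sum>v\<in>A k. c k v * h v) - 0) < \<epsilon>" by auto
  qed
  moreover have "(\<lambda>k. inner (y k) z) \<longlonglongrightarrow> inner ybar z" by (intro tendsto_intros y_tendsto)
  ultimately have "(\<lambda>k. (\<Sum>v\<in>A k. c k v * h v) + inner (y k) z) \<longlonglongrightarrow> 0 + inner ybar z"
    by (rule tendsto_add)
  moreover have "(\<Sum>v\<in>A k. c k v * h v) + inner (y k) z = (\<Sum>v\<in>A k. c k v * f v)" for k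
    by (simp add: h_def y_def inner_sum_left right_diff_distrib sum_subtractf)
  moreover have "inner ybar z = (\<Sum>i\<in>I. f (u i) * inner (w i) ybar)"
    by (simp add: z_def inner_sum_right inner_commute)
  ultimately show ?thesis using inner_dual_ybar[OF w] by (simp add: mult.commute)
qed

section \<open>Localization near the optimal points\<close>

lemma DF_pairing_le:
  assumes L: "\<And>a b. a \<in> region \<Longrightarrow> b \<in> region \<Longrightarrow> norm (DF a - DF b) \<le> L * norm (a - b)"
  shows "inner z (DF (y k) - DF ybar) \<le> norm z * (L * norm (y k - ybar))"
  using L[OF y_region[of k] ybar_region]
  by (intro order.trans[OF norm_cauchy_schwarz] mult_left_mono) auto

text \<open>The dual value at \<open>vhat k\<close> is at least 1 and the gradients converge, so
  \<open>q (vhat k)\<close> tends to 0, whereas \<open>q\<close> is bounded away from 0 outside the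
  sets \<open>W i\<close>.\<close>

lemma vhat_localized:
  assumes W: "\<And>i. i \<in> I \<Longrightarrow> openin X (W i)" "\<And>i. i \<in> I \<Longrightarrow> u i \<in> W i"
  shows "\<forall>\<^sub>F k in sequentially. \<exists>i\<in>I. vhat k \<in> W i"
proof -
  obtain L where L: "0 < L"
    "\<And>a b. a \<in> region \<Longrightarrow> b \<in> region \<Longrightarrow> norm (DF a - DF b) \<le> L * norm (a - b)"
    using DF_lipschitz_region by blast
  obtain R where R: "0 < R" "\<And>v. v \<in> topspace X \<Longrightarrow> norm (K v) \<le> R" using K_bounded by blast
  define S where "S = topspace X - (\<Union>i\<in>I. W i)"
  have "closedin X S" unfolding S_def using W(1) by auto
  moreover have "(1 :: real) = 0" if "v \<in> S" "v \<in> u ` I" for v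
    using that W(2) by (auto simp: S_def)
  \<comment> \<open>Domination of the constant 1 by \<open>1/2 + C * q\<close> on \<open>S\<close>
    is a positive lower bound for \<open>q\<close>; the vanishing condition is void as
    \<open>S\<close> contains no \<open>u i\<close>.\<close>
  ultimately obtain C where C: "0 < C" "\<And>v. v \<in> S \<Longrightarrow> \<bar>1\<bar> \<le> 1/2 + C * q v"
    using domination[of S "\<lambda>_. 1" "1/2"]
    by (metis continuous_map_const half_gt_zero zero_less_one UNIV_I topspace_euclidean)
  have "(\<lambda>k. R * (L * norm (y k - ybar))) \<longlonglongrightarrow> R * (L * norm (ybar - ybar))"
    by (intro tendsto_intros y_tendsto)
  hence "\<forall>\<^sub>F k in sequentially. R * (L * norm (y k - ybar)) < 1 / (2 * C)"
    using C(1) by (intro order_tendstoD(2)) auto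
  thus ?thesis
  proof eventually_elim
    case (elim k)
    have vX: "vhat k \<in> topspace X" using vhat_E E_sub by blast
    have "q (vhat k) = inner (- K (vhat k)) (DF (y k) - DF ybar) - gap k"
      by (simp add: q_def gap_def inner_diff_right)
    also have "\<dots> \<le> norm (- K (vhat k)) * (L * norm (y k - ybar))"
      using DF_pairing_le[OF L(2), of "- K (vhat k)" k] gap_nonneg[of k] by linarith
    also have "\<dots> \<le> R * (L * norm (y k - ybar))"
      using R(2)[OF vX] L(1) by (intro mult_right_mono) auto
    finally have "q (vhat k) < 1 / (2 * C)" using elim by linarith
    hence "C * q (vhat k) < 1 / 2" using C(1) by (simp add: field_simps)
    hence "vhat k \<notin> S" using C(2)[of "vhat k"] by force
    thus ?case using vX by (auto simp: S_def)
  qed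
qed

text \<open>The observation tested with \<open>w i\<close> tends to \<open>lam i\<close>. Outside
  \<open>W\<close> the tested function is dominated by \<open>q\<close> and contributes little;
  inside it is at most \<open>H\<close>, so \<open>W\<close> must carry mass.\<close>

lemma local_mass_lower_bound:
  assumes i: "i \<in> I" and W: "openin X W" "u i \<in> W"
  obtains a where "0 < a" "\<forall>\<^sub>F k in sequentially. a \<le> (\<Sum>v\<in>A k \<inter> W. c k v)"
proof -
  obtain w where w: "\<And>i j. i \<in> I \<Longrightarrow> j \<in> I \<Longrightarrow> inner (w i) (K (u j)) = (if i = j then 1 else 0)"
    using dual_vectors by blast
  obtain R where R: "0 < R" "\<And>v. v \<in> topspace X \<Longrightarrow> norm (K v) \<le> R" using K_bounded by blast
  define h where "h v = inner (K v) (w i)" for v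
  define H where "H = R * (norm (w i) + 1)"
  have "0 < H" using R(1) by (simp add: H_def add_nonneg_pos)
  have H: "h v \<le> H" if "v \<in> topspace X" for v
  proof -
    have "h v \<le> norm (K v) * norm (w i)" unfolding h_def by (rule norm_cauchy_schwarz)
    also have "\<dots> \<le> H" unfolding H_def using R(2)[OF that] R(1) by (intro mult_mono) auto
    finally show ?thesis .
  qed
  \<comment> \<open>The budget is in quarters of \<open>lam i\<close>: three in the tested
    observation, one lost to \<epsilon>, one lost to the residual, one left for
    \<open>W\<close>.\<close>
  define \<epsilon> where "\<epsilon> = lam i / (4 * mass_bound)"
  have \<epsilon>: "0 < \<epsilon>" "\<epsilon> * mass_bound = lam i / 4"
    using lam_pos[OF i] mass_bound_pos by (auto simp: \<epsilon>_def)
  have zero: "h v = 0" if "v \<in> topspace X - W" "v \<in> u ` I" for v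
  proof -
    obtain j where j: "j \<in> I" "v = u j" using \<open>v \<in> u ` I\<close> by blast
    hence "i \<noteq> j" using that W(2) by auto
    thus ?thesis using w[OF i j(1)] j(2) by (simp add: h_def inner_commute)
  qed
  have "closedin X (topspace X - W)" "continuous_map X euclideanreal h"
    using W(1) K_continuous unfolding h_def by auto
  then obtain C where C: "0 < C" "\<And>v. v \<in> topspace X - W \<Longrightarrow> \<bar>h v\<bar> \<le> \<epsilon> + C * q v"
    using domination zero \<epsilon>(1) by blast
  have "(\<lambda>k. inner (y k) (w i)) \<longlonglongrightarrow> inner ybar (w i)" by (intro tendsto_intros y_tendsto)
  moreover have "inner ybar (w i) = lam i" using inner_dual_ybar[OF w i] by (simp add: inner_commute)
  ultimately have "\<forall>\<^sub>F k in sequentially. 3 / 4 * lam i < inner (y k) (w i)"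
    using lam_pos[OF i] by (intro order_tendstoD(1)) auto
  moreover have "\<forall>\<^sub>F k in sequentially. r k < lam i / (4 * C)"
    using r_tendsto_zero lam_pos[OF i] C(1) by (intro order_tendstoD(2)) auto
  ultimately have "\<forall>\<^sub>F k in sequentially. lam i / (4 * H) \<le> (\<Sum>v\<in>A k \<inter> W. c k v)"
  proof eventually_elim
    case (elim k)
    have "inner (y k) (w i) = (\<Sum>v\<in>A k. c k v * h v)" by (simp add: y_def h_def inner_sum_left)
    also have "\<dots> = (\<Sum>v\<in>A k \<inter> W. c k v * h v) + (\<Sum>v\<in>A k - W. c k v * h v)"
      using A_finite by (rule sum.Int_Diff)
    also have "(\<Sum>v\<in>A k - W. c k v * h v) \<le> \<epsilon> * mass_bound + C * r k"
      using C A_sub \<epsilon> by (intro order.trans[OF abs_ge_self dominated_sum_le]) auto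
    also have "(\<Sum>v\<in>A k \<inter> W. c k v * h v) \<le> (\<Sum>v\<in>A k \<inter> W. c k v * H)"
      using H A_sub c_pos by (intro sum_mono mult_left_mono) (auto intro: less_imp_le)
    finally have "inner (y k) (w i) \<le> (\<Sum>v\<in>A k \<inter> W. c k v) * H + lam i / 4 + C * r k"
      using \<epsilon>(2) by (simp add: sum_distrib_right)
    moreover have "C * r k < lam i / 4" using elim(2) C(1) by (simp add: field_simps)
    ultimately have "lam i / 4 \<le> (\<Sum>v\<in>A k \<inter> W. c k v) * H" using elim(1) by linarith
    thus ?case using \<open>0 < H\<close> by (simp add: field_simps)
  qed
  thus thesis using that[of "lam i / (4 * H)"] \<open>0 < H\<close> lam_pos[OF i] by simp
qed

section \<open>The linear rate\<close>

text \<open>Strong monotonicity is applied once, between \<open>ybar\<close> and the midpoint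
  \<open>ybar + d\<close>; two tangent inequalities bound the result by the Bregman distance.
  Halving the segment costs the factor 4.\<close>

lemma norm_sq_le_bregman:
  assumes \<theta>: "\<And>a b. a \<in> ball ybar \<delta> \<Longrightarrow> b \<in> ball ybar \<delta> \<Longrightarrow>
      \<theta> * (norm (a - b))\<^sup>2 \<le> inner (DF a - DF b) (a - b)"
    and z: "z \<in> ball ybar \<delta>"
  shows "\<theta> * (norm (z - ybar))\<^sup>2 \<le> 4 * bregman z"
proof -
  define d where "d = (1/2) *\<^sub>R (z - ybar)"
  have zd: "z - ybar = 2 *\<^sub>R d" by (simp add: d_def)
  have z_eq: "z = ybar + 2 *\<^sub>R d" by (simp add: d_def)
  have "ybar + d \<in> ball ybar \<delta>" "ybar \<in> ball ybar \<delta>"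
    using z by (auto simp: z_eq dist_norm intro: le_less_trans[of _ "2 * norm d"])
  from \<theta>[OF this] have 1: "\<theta> * (norm d)\<^sup>2 \<le> inner (DF (ybar + d) - DF ybar) d" by simp
  have "F (ybar + d) + inner (DF (ybar + d)) d \<le> F z"
    using F_tangent[of "ybar + d" z] by (simp add: z_eq scaleR_2)
  moreover have "F ybar + inner (DF ybar) d \<le> F (ybar + d)"
    using F_tangent[of ybar "ybar + d"] by simp
  ultimately have "inner (DF (ybar + d) - DF ybar) d \<le> bregman z"
    by (simp add: bregman_def zd inner_diff_left)
  moreover have "(norm (z - ybar))\<^sup>2 = 4 * (norm d)\<^sup>2" by (simp add: zd power_mult_distrib)
  ultimately show ?thesis using 1 by simp
qed

text \<open>The mass near \<open>u i\<close> is moved to the new point in \<open>U i\<close>; the quadratic growth of the dual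
  certificate makes the squared displacement of the observation of the order of the residual.\<close>

theorem linear_convergence:
  fixes g :: "'v \<Rightarrow> 'v \<Rightarrow> real"
  assumes "0 < \<delta>" "0 < \<theta>" "0 < \<tau>" "0 < \<kappa>"
    and \<theta>: "\<And>a b. a \<in> ball ybar \<delta> \<Longrightarrow> b \<in> ball ybar \<delta> \<Longrightarrow>
      \<theta> * (norm (a - b))\<^sup>2 \<le> inner (DF a - DF b) (a - b)"
    and U: "\<And>i. i \<in> I \<Longrightarrow> u i \<in> X interior_of U i"
    and g_nonneg: "\<And>v w. v \<in> E \<Longrightarrow> w \<in> E \<Longrightarrow> 0 \<le> g v w"
    and K_growth: "\<And>i v. i \<in> I \<Longrightarrow> v \<in> U i \<inter> E \<Longrightarrow> norm (K v - K (u i)) \<le> \<tau> * g v (u i)"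
    and q_growth: "\<And>i v. i \<in> I \<Longrightarrow> v \<in> U i \<inter> E \<Longrightarrow> \<kappa> * (g v (u i))\<^sup>2 \<le> q v"
  obtains \<zeta> where "\<zeta> \<in> {3/4..<1}" "\<forall>\<^sub>F k in sequentially. r (Suc k) \<le> \<zeta> * r k"
proof -
  obtain L where L: "0 < L"
    "\<And>a b. a \<in> region \<Longrightarrow> b \<in> region \<Longrightarrow> norm (DF a - DF b) \<le> L * norm (a - b)"
    using DF_lipschitz_region by blast
  define W where "W i = X interior_of U i" for i
  have W: "openin X (W i)" "W i \<subseteq> U i" for i
    by (auto simp: W_def interior_of_subset)
  have "\<exists>a>0. \<forall>\<^sub>F k in sequentially. a \<le> (\<Sum>v\<in>A k \<inter> W i. c k v)" if "i \<in> I" for i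
    using local_mass_lower_bound[OF that W(1)] U[OF that] unfolding W_def by blast
  then obtain a where a: "\<And>i. i \<in> I \<Longrightarrow> 0 < a i"
    "\<And>i. i \<in> I \<Longrightarrow> \<forall>\<^sub>F k in sequentially. a i \<le> (\<Sum>v\<in>A k \<inter> W i. c k v)" by metis
  define a0 where "a0 = Min (a ` I)"
  have a0: "0 < a0" "\<And>i. i \<in> I \<Longrightarrow> a0 \<le> a i"
    using a(1) I_finite I_nonempty by (auto simp: a0_def)
  \<comment> \<open>\<open>\<eta>\<close> will bound the square of \<open>g (vhat k) (u i)\<close>
    relative to the residual: \<open>L * \<tau> / \<kappa>\<close> comes from the two growth
    conditions, \<open>4 / \<theta>\<close> from \<open>norm_sq_le_bregman\<close>. \<open>D\<close>
    then bounds the squared displacement relative to the residual.\<close>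
  define \<eta> where "\<eta> = (L * \<tau> / \<kappa>)\<^sup>2 * (4 / \<theta>)"
  define D where "D = 2 * \<tau>\<^sup>2 * (mass_bound\<^sup>2 * \<eta> + mass_bound / \<kappa>)"
  have \<eta>: "0 \<le> \<eta>" using assms(2) by (simp add: \<eta>_def)
  have D: "0 \<le> D" using \<eta> mass_bound_pos assms(4) by (simp add: D_def)
  have step: "r (Suc k) \<le> r k - s * (a0 / weight) * r k + (L * D) * s\<^sup>2 * r k"
    if k: "i \<in> I" "vhat k \<in> W i" "a0 \<le> (\<Sum>v\<in>A k \<inter> W i. c k v)" "y k \<in> ball ybar \<delta>"
      and s: "0 \<le> s" "s \<le> 1" for i k s
  proof -
    \<comment> \<open>Only the weight inside \<open>W i\<close> is moved, onto an atom of equal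
      weight at \<open>vhat k\<close>, so the total mass does not change.\<close>
    define e where "e v = (if v \<in> W i then c k v else 0)" for v
    define t where "t = (\<Sum>v\<in>A k \<inter> W i. c k v)"
    define gh where "gh = g (vhat k) (u i)"
    define \<gamma> where "\<gamma> = (\<Sum>v\<in>A k \<inter> W i. c k v * g v (u i))"
    have uE: "u i \<in> E" by (rule u_E[OF k(1)])
    have restrict: "(\<Sum>v\<in>A k. e v *\<^sub>R f v) = (\<Sum>v\<in>A k \<inter> W i. c k v *\<^sub>R f v)" for f :: "'v \<Rightarrow> 'z::real_vector"
      using A_finite by (intro sum.mono_neutral_cong_right) (auto simp: e_def)
    have sum_e: "sum e (A k) = t"
      using restrict[of "\<lambda>_. 1 :: real"] by (simp add: t_def)
    have t: "0 \<le> t" unfolding t_def using c_pos by (intro sum_nonneg) (auto intro: less_imp_le)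
    have t_le: "t \<le> mass_bound"
    proof -
      have "t \<le> mass k"
        unfolding t_def mass_def using A_finite c_pos
        by (intro sum_mono2) (auto intro: less_imp_le)
      thus ?thesis using mass_le[of k] by linarith
    qed
    have gh: "0 \<le> gh" unfolding gh_def using g_nonneg vhat_E uE by blast
    have gA: "0 \<le> g v (u i)" if "v \<in> A k" for v using g_nonneg A_E uE that by blast
    have \<gamma>: "0 \<le> \<gamma>" unfolding \<gamma>_def using c_pos gA
      by (intro sum_nonneg mult_nonneg_nonneg) (auto intro: less_imp_le)
    have vU: "vhat k \<in> U i \<inter> E" using k(2) W(2) vhat_E by blast
    \<comment> \<open>Optimality of \<open>vhat k\<close> against \<open>u i\<close> bounds
      \<open>q (vhat k)\<close> by a gradient difference paired with
      \<open>K (u i) - K (vhat k)\<close>. Cancelling one factor \<open>gh\<close> turns quadratic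
      growth into a bound linear in \<open>norm (y k - ybar)\<close>.\<close>
    have "gh\<^sup>2 \<le> \<eta> * r k"
    proof -
      have "inner (K (u i)) (DF ybar) = - 1"
        using q_zero[OF u_in[OF k(1)]] k(1) unfolding q_def by force
      moreover have "inner (K (vhat k)) (DF (y k)) \<le> inner (K (u i)) (DF (y k))"
        unfolding y_def by (rule vhat_max[OF uE])
      ultimately have "q (vhat k) \<le> inner (K (u i) - K (vhat k)) (DF (y k) - DF ybar)"
        by (simp add: q_def inner_diff_left inner_diff_right)
      also have "\<dots> \<le> norm (K (u i) - K (vhat k)) * (L * norm (y k - ybar))"
        by (rule DF_pairing_le[OF L(2)])
      also have "\<dots> \<le> (\<tau> * gh) * (L * norm (y k - ybar))"
        using K_growth[OF k(1) vU] L(1) unfolding gh_def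
        by (intro mult_right_mono) (auto simp: norm_minus_commute)
      finally have "\<kappa> * gh\<^sup>2 \<le> (\<tau> * gh) * (L * norm (y k - ybar))"
        using q_growth[OF k(1) vU] by (simp add: gh_def)
      hence "gh * (\<kappa> * gh) \<le> gh * (L * \<tau> * norm (y k - ybar))"
        by (simp add: power2_eq_square algebra_simps)
      hence "\<kappa> * gh \<le> L * \<tau> * norm (y k - ybar)"
        using gh L(1) assms(3) by (cases "gh = 0") auto
      hence "gh \<le> (L * \<tau> / \<kappa>) * norm (y k - ybar)" using assms(4) by (simp add: field_simps)
      hence "gh\<^sup>2 \<le> ((L * \<tau> / \<kappa>) * norm (y k - ybar))\<^sup>2" using gh by (rule power_mono)
      also have "\<dots> = (L * \<tau> / \<kappa>)\<^sup>2 * (norm (y k - ybar))\<^sup>2" by (rule power_mult_distrib)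
      also have "\<dots> \<le> (L * \<tau> / \<kappa>)\<^sup>2 * ((4 / \<theta>) * r k)"
      proof (intro mult_left_mono)
        have "\<theta> * (norm (y k - ybar))\<^sup>2 \<le> 4 * r k"
          using norm_sq_le_bregman[OF \<theta> k(4)] bregman_le_r[of k] by linarith
        thus "(norm (y k - ybar))\<^sup>2 \<le> (4 / \<theta>) * r k" using assms(2) by (simp add: field_simps)
      qed simp
      finally show ?thesis by (simp add: \<eta>_def)
    qed
    hence new: "t\<^sup>2 * gh\<^sup>2 \<le> mass_bound\<^sup>2 * (\<eta> * r k)"
      using t t_le by (intro mult_mono power_mono) auto
    \<comment> \<open>Cauchy-Schwarz with weights \<open>c k\<close> reduces this to the sum of the
      squares of \<open>g\<close>, which the growth of \<open>q\<close> bounds by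
      \<open>r k / \<kappa>\<close>.\<close>
    have old: "\<gamma>\<^sup>2 \<le> mass_bound * (r k / \<kappa>)"
    proof -
      have "\<kappa> * (\<Sum>v\<in>A k \<inter> W i. c k v * (g v (u i))\<^sup>2) = (\<Sum>v\<in>A k \<inter> W i. c k v * (\<kappa> * (g v (u i))\<^sup>2))"
        by (simp add: sum_distrib_left mult.left_commute)
      also have "\<dots> \<le> (\<Sum>v\<in>A k \<inter> W i. c k v * q v)"
      proof (intro sum_mono mult_left_mono)
        fix v assume v: "v \<in> A k \<inter> W i"
        thus "\<kappa> * (g v (u i))\<^sup>2 \<le> q v" using q_growth[OF k(1)] W(2) A_E by blast
        show "0 \<le> c k v" using c_pos v by (auto intro: less_imp_le)
      qed
      also have "\<dots> \<le> (\<Sum>v\<in>A k. c k v * q v)"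
        using A_finite c_pos q_nonneg A_sub
        by (intro sum_mono2 mult_nonneg_nonneg) (auto intro: less_imp_le)
      also have "\<dots> \<le> r k" by (rule sum_q_le_r)
      finally have "(\<Sum>v\<in>A k \<inter> W i. c k v * (g v (u i))\<^sup>2) \<le> r k / \<kappa>"
        using assms(4) by (simp add: field_simps)
      hence "t * (\<Sum>v\<in>A k \<inter> W i. c k v * (g v (u i))\<^sup>2) \<le> mass_bound * (r k / \<kappa>)"
        using t t_le mass_bound_pos c_pos
        by (intro mult_mono sum_nonneg mult_nonneg_nonneg) (auto intro: less_imp_le)
      moreover have "\<gamma>\<^sup>2 \<le> t * (\<Sum>v\<in>A k \<inter> W i. c k v * (g v (u i))\<^sup>2)"
        unfolding \<gamma>_def t_def using c_pos by (intro weighted_sum_square_le) (auto intro: less_imp_le)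
      ultimately show ?thesis by linarith
    qed
    have "(norm (t *\<^sub>R K (vhat k) - (\<Sum>v\<in>A k. e v *\<^sub>R K v)))\<^sup>2 \<le> 2 * \<tau>\<^sup>2 * (t\<^sup>2 * gh\<^sup>2 + \<gamma>\<^sup>2)"
    proof -
      \<comment> \<open>Removed and added weight agree, so \<open>K (u i)\<close> can be subtracted
        in both terms.\<close>
      have "t *\<^sub>R K (vhat k) - (\<Sum>v\<in>A k. e v *\<^sub>R K v)
        = t *\<^sub>R (K (vhat k) - K (u i)) - (\<Sum>v\<in>A k \<inter> W i. c k v *\<^sub>R (K v - K (u i)))"
        unfolding restrict
        by (simp add: scaleR_right_diff_distrib sum_subtractf t_def scaleR_sum_left)
      also have "norm \<dots> \<le> norm (t *\<^sub>R (K (vhat k) - K (u i)))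
          + norm (\<Sum>v\<in>A k \<inter> W i. c k v *\<^sub>R (K v - K (u i)))"
        by (rule norm_triangle_ineq4)
      also have "norm (t *\<^sub>R (K (vhat k) - K (u i))) \<le> t * (\<tau> * gh)"
        using K_growth[OF k(1) vU] t unfolding gh_def by (auto intro: mult_left_mono)
      also have "norm (\<Sum>v\<in>A k \<inter> W i. c k v *\<^sub>R (K v - K (u i)))
          \<le> (\<Sum>v\<in>A k \<inter> W i. c k v * (\<tau> * g v (u i)))"
      proof (intro order.trans[OF norm_sum] sum_mono)
        fix v assume v: "v \<in> A k \<inter> W i"
        hence "norm (K v - K (u i)) \<le> \<tau> * g v (u i)" using K_growth[OF k(1)] W(2) A_E by blast
        thus "norm (c k v *\<^sub>R (K v - K (u i))) \<le> c k v * (\<tau> * g v (u i))"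
          using c_pos[of v k] v by (auto intro: mult_left_mono)
      qed
      also have "\<dots> = \<tau> * \<gamma>" by (simp add: \<gamma>_def sum_distrib_left mult.left_commute)
      finally have "norm (t *\<^sub>R K (vhat k) - (\<Sum>v\<in>A k. e v *\<^sub>R K v)) \<le> \<tau> * (t * gh + \<gamma>)"
        by (simp add: algebra_simps)
      hence "(norm (t *\<^sub>R K (vhat k) - (\<Sum>v\<in>A k. e v *\<^sub>R K v)))\<^sup>2 \<le> (\<tau> * (t * gh + \<gamma>))\<^sup>2"
        by (rule power_mono) simp
      also have "\<dots> = \<tau>\<^sup>2 * (t * gh + \<gamma>)\<^sup>2" by (rule power_mult_distrib)
      also have "\<dots> \<le> \<tau>\<^sup>2 * (2 * (t\<^sup>2 * gh\<^sup>2 + \<gamma>\<^sup>2))"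
      proof (rule mult_left_mono)
        show "(t * gh + \<gamma>)\<^sup>2 \<le> 2 * (t\<^sup>2 * gh\<^sup>2 + \<gamma>\<^sup>2)"
          using zero_le_power2[of "t * gh - \<gamma>"]
          by (simp add: power2_sum power2_diff power_mult_distrib algebra_simps)
      qed simp
      finally show ?thesis by (simp add: algebra_simps)
    qed
    also have "\<dots> \<le> 2 * \<tau>\<^sup>2 * (mass_bound\<^sup>2 * (\<eta> * r k) + mass_bound * (r k / \<kappa>))"
      using new old by (intro mult_left_mono add_mono) auto
    also have "\<dots> = D * r k" by (simp add: D_def algebra_simps)
    finally have disp: "(norm (t *\<^sub>R K (vhat k) - (\<Sum>v\<in>A k. e v *\<^sub>R K v)))\<^sup>2 \<le> D * r k" .
    have "r (Suc k) \<le> r k - s * (t / weight) * r k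
      + L * s\<^sup>2 * (norm (t *\<^sub>R K (vhat k) - (\<Sum>v\<in>A k. e v *\<^sub>R K v)))\<^sup>2"
      using c_pos t s mass_le sum_e
      by (intro transfer_descent[OF L(2)]) (auto simp: e_def less_imp_le)
    also have "\<dots> \<le> r k - s * (a0 / weight) * r k + L * s\<^sup>2 * (D * r k)"
      using disp L(1) s k(3) weight_pos r_nonneg[of k] unfolding t_def[symmetric]
      by (intro add_mono diff_mono mult_left_mono mult_right_mono divide_right_mono) auto
    finally show ?thesis by (simp add: algebra_simps)
  qed
  define \<alpha> where "\<alpha> = a0 / weight"
  define \<beta> where "\<beta> = L * D"
  have \<alpha>: "0 < \<alpha>" and \<beta>: "0 \<le> \<beta>"
    using a0(1) weight_pos L(1) D by (auto simp: \<alpha>_def \<beta>_def)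
  \<comment> \<open>With this step the quadratic term uses up at most half of the linear gain;
    \<alpha> in the denominator keeps \<open>s\<close> below 1 even if \<beta> is 0.\<close>
  define s where "s = \<alpha> / (2 * (\<alpha> + \<beta>))"
  \<comment> \<open>The maximum places the rate in the required range; enlarging it is harmless
    since residuals are nonnegative.\<close>
  define \<zeta> where "\<zeta> = max (3/4) (1 - s * \<alpha> / 2)"
  have s: "0 < s" "s \<le> 1" using \<alpha> \<beta> by (auto simp: s_def field_simps)
  have "\<beta> * s \<le> \<alpha> / 2" using \<alpha> \<beta> by (simp add: s_def field_simps)
  hence "s * (\<beta> * s) \<le> s * (\<alpha> / 2)" using s by (intro mult_left_mono) auto
  hence factor: "1 - s * \<alpha> + \<beta> * s\<^sup>2 \<le> \<zeta>"
    by (simp add: \<zeta>_def power2_eq_square algebra_simps)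
  have "\<forall>\<^sub>F k in sequentially. \<exists>i\<in>I. vhat k \<in> W i"
    using U W(1) by (intro vhat_localized) (auto simp: W_def)
  moreover have "\<forall>\<^sub>F k in sequentially. \<forall>i\<in>I. a i \<le> (\<Sum>v\<in>A k \<inter> W i. c k v)"
    using I_finite a(2) by (simp add: eventually_ball_finite)
  moreover have "\<forall>\<^sub>F k in sequentially. y k \<in> ball ybar \<delta>"
    using y_tendsto \<open>0 < \<delta>\<close> by (auto simp: tendsto_iff dist_commute)
  ultimately have "\<forall>\<^sub>F k in sequentially. r (Suc k) \<le> \<zeta> * r k"
  proof eventually_elim
    case (elim k)
    then obtain i where i: "i \<in> I" "vhat k \<in> W i" by blast
    have "a0 \<le> (\<Sum>v\<in>A k \<inter> W i. c k v)" using elim(2) a0(2) i(1) by (meson order.trans)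
    hence "r (Suc k) \<le> r k - s * (a0 / weight) * r k + (L * D) * s\<^sup>2 * r k"
      using step[OF i _ elim(3)] s by simp
    also have "\<dots> = (1 - s * \<alpha> + \<beta> * s\<^sup>2) * r k" by (simp add: \<alpha>_def \<beta>_def algebra_simps)
    also have "\<dots> \<le> \<zeta> * r k" using factor r_nonneg by (rule mult_right_mono)
    finally show ?case .
  qed
  moreover have "\<zeta> \<in> {3/4..<1}" using s \<alpha> by (auto simp: \<zeta>_def)
  ultimately show thesis using that by blast
qed

end

subsection \<open>Finite sums of Dirac measures and the lifted problem\<close>

lemma space_borel_of_topology [simp]: "space (borel_of_topology X) = topspace X"
  unfolding borel_of_topology_def by (rule space_measure_of) (auto dest: openin_subset)

lemma openin_borel_of_topology: "openin X S \<Longrightarrow> S \<in> sets (borel_of_topology X)"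
  unfolding borel_of_topology_def by (subst sets_measure_of) (auto dest: openin_subset)

lemma closedin_borel_of_topology:
  assumes "closedin X S" shows "S \<in> sets (borel_of_topology X)"
proof -
  have "topspace X - (topspace X - S) \<in> sets (borel_of_topology X)"
    using assms sets.top[of "borel_of_topology X"]
    by (intro sets.Diff openin_borel_of_topology) auto
  thus ?thesis using closedin_subset[OF assms] by (simp add: double_diff)
qed

lemma continuous_map_borel_measurable:
  assumes "continuous_map X euclidean f"
  shows "f \<in> borel_measurable (borel_of_topology X)"
proof (rule borel_measurableI)
  fix S :: "'b set" assume "open S"
  hence "openin X {x \<in> topspace X. f x \<in> S}"
    using openin_continuous_map_preimage[OF assms] by simp
  moreover have "f -` S \<inter> space (borel_of_topology X) = {x \<in> topspace X. f x \<in> S}" by auto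
  ultimately show "f -` S \<inter> space (borel_of_topology X) \<in> sets (borel_of_topology X)"
    by (simp add: openin_borel_of_topology)
qed

text \<open>\<open>measure_of\<close> denotes the given set function only if it is countably
  additive; the push-forward of a point measure supplies this, together with the integral
  formula.\<close>

lemma dirac_sum_eq_distr:
  assumes I: "finite I" and u: "\<And>i. i \<in> I \<Longrightarrow> u i \<in> topspace X"
  shows "dirac_sum X I lam u = distr (point_measure I (\<lambda>i. ennreal (lam i))) (borel_of_topology X) u"
    (is "_ = ?D")
proof -
  have "dirac_sum X I lam u = measure_of (space ?D) (sets ?D) (emeasure ?D)"
    unfolding dirac_sum_def
  proof (simp, rule measure_of_eq)
    show "sets (borel_of_topology X) \<subseteq> Pow (topspace X)"
      using sets.sets_into_space[of _ "borel_of_topology X"] by auto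
    fix E assume "E \<in> sigma_sets (topspace X) (sets (borel_of_topology X))"
    hence E: "E \<in> sets (borel_of_topology X)"
      using sets.sigma_sets_eq[of "borel_of_topology X"] by simp
    have "emeasure ?D E = emeasure (point_measure I (\<lambda>i. ennreal (lam i))) (u -` E \<inter> I)"
      using E u by (subst emeasure_distr) (auto simp: space_point_measure)
    also have "\<dots> = (\<Sum>i\<in>u -` E \<inter> I. ennreal (lam i))"
      using I by (simp add: emeasure_point_measure_finite)
    also have "\<dots> = (\<Sum>i\<in>I. ennreal (lam i) * indicator E (u i))"
      using I by (intro sum.mono_neutral_cong_left) (auto simp: indicator_def)
    finally show "(\<Sum>i\<in>I. ennreal (lam i) * indicator E (u i)) = emeasure ?D E" by simp
  qed
  thus ?thesis unfolding measure_of_of_measure .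
qed

lemma sets_dirac_sum [simp]: "sets (dirac_sum X I lam u) = sets (borel_of_topology X)"
  unfolding dirac_sum_def
  using sets.space_closed[of "borel_of_topology X"] sets.sigma_sets_eq[of "borel_of_topology X"]
  by simp

lemma space_dirac_sum [simp]: "space (dirac_sum X I lam u) = topspace X"
  using sets_eq_imp_space_eq[OF sets_dirac_sum] by simp

lemma emeasure_dirac_sum:
  assumes I: "finite I" and u: "\<And>i. i \<in> I \<Longrightarrow> u i \<in> topspace X"
    and E: "E \<in> sets (borel_of_topology X)"
  shows "emeasure (dirac_sum X I lam u) E = (\<Sum>i\<in>I. ennreal (lam i) * indicator E (u i))"
proof -
  have "emeasure (dirac_sum X I lam u) E
    = emeasure (point_measure I (\<lambda>i. ennreal (lam i))) (u -` E \<inter> I)"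
    using E u by (simp add: dirac_sum_eq_distr[OF I u] emeasure_distr space_point_measure)
  also have "\<dots> = (\<Sum>i\<in>u -` E \<inter> I. ennreal (lam i))"
    using I by (simp add: emeasure_point_measure_finite)
  also have "\<dots> = (\<Sum>i\<in>I. ennreal (lam i) * indicator E (u i))"
    using I by (intro sum.mono_neutral_cong_left) (auto simp: indicator_def)
  finally show ?thesis .
qed

lemma integral_dirac_sum:
  fixes f :: "'a \<Rightarrow> real"
  assumes "finite I" "\<And>i. i \<in> I \<Longrightarrow> u i \<in> topspace X" "\<And>i. i \<in> I \<Longrightarrow> 0 \<le> lam i"
    and "f \<in> borel_measurable (borel_of_topology X)"
  shows "(\<integral>v. f v \<partial>dirac_sum X I lam u) = (\<Sum>i\<in>I. lam i * f (u i))"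
  using assms
  by (simp add: dirac_sum_eq_distr integral_distr lebesgue_integral_point_measure_finite)

lemma mass_dirac_sum:
  assumes "finite I" "\<And>i. i \<in> I \<Longrightarrow> u i \<in> topspace X" "\<And>i. i \<in> I \<Longrightarrow> 0 \<le> lam i"
  shows "measure (dirac_sum X I lam u) (space (dirac_sum X I lam u)) = sum lam I"
proof -
  have "emeasure (dirac_sum X I lam u) (topspace X) = ennreal (sum lam I)"
    using assms sets.top[of "borel_of_topology X"] by (simp add: emeasure_dirac_sum)
  thus ?thesis using assms by (simp add: measure_def sum_nonneg)
qed

lemma dirac_sum_pos_measure:
  assumes "finite I" "\<And>i. i \<in> I \<Longrightarrow> u i \<in> topspace X"
  shows "dirac_sum X I lam u \<in> pos_measures X"
proof -
  have "emeasure (dirac_sum X I lam u) (topspace X) < \<infinity>"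
    using assms sets.top[of "borel_of_topology X"] by (simp add: emeasure_dirac_sum)
  thus ?thesis by (auto simp: pos_measures_def intro!: finite_measureI)
qed

lemma dirac_sum_cong:
  assumes "\<And>i. i \<in> I \<Longrightarrow> a i = b i"
  shows "dirac_sum X I a u = dirac_sum X I b u"
  unfolding dirac_sum_def using assms by (simp cong: sum.cong)

lemma dirac_sum_mono_neutral:
  assumes "finite T" "S \<subseteq> T" "\<And>v. v \<in> T - S \<Longrightarrow> c v = 0"
  shows "dirac_sum X T c u = dirac_sum X S c u"
proof -
  have "(\<Sum>i\<in>T. ennreal (c i) * indicator E (u i)) = (\<Sum>i\<in>S. ennreal (c i) * indicator E (u i))" for E
    using assms by (intro sum.mono_neutral_right) auto
  thus ?thesis by (simp add: dirac_sum_def)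
qed

text \<open>Each neighbourhood of an atom of positive weight is charged. Conversely, in a T1 space
  the complement of these finitely many atoms is an open null set.\<close>

lemma msupport_dirac_sum:
  assumes X: "t1_space X" and T: "finite T" "T \<subseteq> topspace X" and c: "\<And>v. v \<in> T \<Longrightarrow> 0 \<le> c v"
  shows "msupport X (dirac_sum X T c (\<lambda>v. v)) = {v \<in> T. 0 < c v}"
proof (intro equalityI subsetI)
  fix v assume v: "v \<in> {v \<in> T. 0 < c v}"
  have "emeasure (dirac_sum X T c (\<lambda>v. v)) W \<noteq> 0" if W: "openin X W" "v \<in> W" for W
  proof -
    have "emeasure (dirac_sum X T c (\<lambda>v. v)) W = (\<Sum>i\<in>T. ennreal (c i) * indicator W i)"
      using T W by (intro emeasure_dirac_sum) (auto simp: openin_borel_of_topology)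
    moreover have "ennreal (c v) \<le> (\<Sum>i\<in>T. ennreal (c i) * indicator W i)"
      using member_le_sum[of v T "\<lambda>i. ennreal (c i) * indicator W i"] v W T by simp
    ultimately show ?thesis using v by auto
  qed
  thus "v \<in> msupport X (dirac_sum X T c (\<lambda>v. v))"
    using v T by (auto simp: msupport_def)
next
  fix v assume v: "v \<in> msupport X (dirac_sum X T c (\<lambda>v. v))"
  show "v \<in> {v \<in> T. 0 < c v}"
  proof (rule ccontr)
    assume nv: "v \<notin> {v \<in> T. 0 < c v}"
    define W where "W = topspace X - {w \<in> T. 0 < c w}"
    have "finite {w \<in> T. 0 < c w}" "{w \<in> T. 0 < c w} \<subseteq> topspace X" using T by auto
    hence "closedin X {w \<in> T. 0 < c w}" using X unfolding t1_space_closedin_finite by blast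
    hence "openin X W" by (simp add: W_def openin_diff)
    moreover have "v \<in> W" using v nv by (auto simp: W_def msupport_def)
    moreover have "emeasure (dirac_sum X T c (\<lambda>v. v)) W = (\<Sum>i\<in>T. ennreal (c i) * indicator W i)"
      using T \<open>openin X W\<close> by (intro emeasure_dirac_sum) (auto simp: openin_borel_of_topology)
    moreover have "\<dots> = 0"
      using c by (intro sum.neutral) (force simp: W_def indicator_def)
    ultimately show False using v by (auto simp: msupport_def)
  qed
qed

section \<open>Weak integrals and the lifted objective\<close>

lemma pos_measures_integrable:
  fixes f :: "'a \<Rightarrow> real"
  assumes "\<nu> \<in> pos_measures X" "compact_space X" "continuous_map X euclideanreal f"
  shows "integrable \<nu> f"
proof -
  interpret finite_measure \<nu> using assms(1) by (simp add: pos_measures_def)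
  have sets: "sets \<nu> = sets (borel_of_topology X)" using assms(1) by (simp add: pos_measures_def)
  have space: "space \<nu> = topspace X" using sets_eq_imp_space_eq[OF sets] by simp
  have "compactin euclideanreal (f ` topspace X)"
    using assms(2,3) image_compactin compact_space_def by blast
  then obtain B where "\<And>v. v \<in> topspace X \<Longrightarrow> norm (f v) \<le> B"
    using compact_imp_bounded by (force simp: bounded_iff)
  thus ?thesis
    using continuous_map_borel_measurable[OF assms(3)] measurable_cong_sets[OF sets refl] space
    by (intro integrable_const_bound[of _ B]) auto
qed

lemma lifted_op_eqI:
  assumes "\<And>y. inner z y = (\<integral>v. inner (K v) y \<partial>\<nu>)"
  shows "lifted_op K \<nu> = z"
  unfolding lifted_op_def
proof (rule the_equality)
  show "\<forall>y. inner z y = (\<integral>v. inner (K v) y \<partial>\<nu>)" using assms by blast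
  fix z' assume "\<forall>y. inner z' y = (\<integral>v. inner (K v) y \<partial>\<nu>)"
  hence "inner (z' - z) (z' - z) = 0" using assms by (simp add: inner_diff_left)
  thus "z' = z" by simp
qed

lemma lifted_op_dirac_sum:
  assumes "finite I" "\<And>i. i \<in> I \<Longrightarrow> u i \<in> topspace X" "\<And>i. i \<in> I \<Longrightarrow> 0 \<le> lam i"
    and K: "\<And>y. continuous_map X euclideanreal (\<lambda>v. inner (K v) y)"
  shows "lifted_op K (dirac_sum X I lam u) = (\<Sum>i\<in>I. lam i *\<^sub>R K (u i))"
  using assms
  by (intro lifted_op_eqI)
    (simp add: integral_dirac_sum continuous_map_borel_measurable inner_sum_left)

lemma lifted_objective_dirac_sum:
  assumes "finite I" "\<And>i. i \<in> I \<Longrightarrow> u i \<in> topspace X" "\<And>i. i \<in> I \<Longrightarrow> 0 \<le> lam i"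
    and "\<And>y. continuous_map X euclideanreal (\<lambda>v. inner (K v) y)"
  shows "lifted_objective F K (dirac_sum X I lam u) = F (\<Sum>i\<in>I. lam i *\<^sub>R K (u i)) + sum lam I"
  unfolding lifted_objective_def
  using mass_dirac_sum[OF assms(1-3)] lifted_op_dirac_sum[OF assms] by simp

locale dual_sparse_problem = sparse_problem F DF K X I u lam ybar
  for F :: "'y::{real_inner,complete_space} \<Rightarrow> real" and DF
    and K :: "'c::real_normed_vector dual \<Rightarrow> 'y" and X and I :: "'i set" and u lam ybar
begin

abbreviation J :: "'c dual measure \<Rightarrow> real" where "J \<equiv> lifted_objective F K"

text \<open>The integrals form a linear functional bounded by \<open>R\<close> times the mass, so
  the Riesz representation supplies the vector selected by the \<open>THE\<close> in
  \<open>lifted_op\<close>.\<close>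

lemma inner_lifted_op:
  assumes \<nu>: "\<nu> \<in> pos_measures X"
  shows "inner (lifted_op K \<nu>) y = (\<integral>v. inner (K v) y \<partial>\<nu>)"
proof -
  interpret finite_measure \<nu> using \<nu> by (simp add: pos_measures_def)
  have sets: "sets \<nu> = sets (borel_of_topology X)" using \<nu> by (simp add: pos_measures_def)
  have space: "space \<nu> = topspace X" using sets_eq_imp_space_eq[OF sets] by simp
  have int: "integrable \<nu> (\<lambda>v. inner (K v) y)" for y
    by (rule pos_measures_integrable[OF \<nu> X_compact K_continuous])
  obtain R where R: "0 < R" "\<And>v. v \<in> topspace X \<Longrightarrow> norm (K v) \<le> R" using K_bounded by blast
  have "bounded_linear (\<lambda>y. \<integral>v. inner (K v) y \<partial>\<nu>)"
  proof (rule bounded_linear_intro)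
    fix x y
    show "(\<integral>v. inner (K v) (x + y) \<partial>\<nu>) = (\<integral>v. inner (K v) x \<partial>\<nu>) + (\<integral>v. inner (K v) y \<partial>\<nu>)"
      using int by (simp add: inner_add_right)
    show "(\<integral>v. inner (K v) (a *\<^sub>R x) \<partial>\<nu>) = a *\<^sub>R (\<integral>v. inner (K v) x \<partial>\<nu>)" for a
      by simp
    have "norm (\<integral>v. inner (K v) x \<partial>\<nu>) \<le> (\<integral>v. norm (inner (K v) x) \<partial>\<nu>)" by (rule integral_norm_bound)
    also have "\<dots> \<le> (\<integral>v. R * norm x \<partial>\<nu>)"
    proof (rule integral_mono)
      fix v assume "v \<in> space \<nu>"
      hence "norm (K v) * norm x \<le> R * norm x" using R space by (intro mult_right_mono) auto
      thus "norm (inner (K v) x) \<le> R * norm x"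
        using Cauchy_Schwarz_ineq2[of "K v" x] by simp
    qed (use int in auto)
    finally show "norm (\<integral>v. inner (K v) x \<partial>\<nu>) \<le> norm x * (measure \<nu> (space \<nu>) * R)"
      by (simp add: mult_ac)
  qed
  then obtain z where "\<And>y. (\<integral>v. inner (K v) y \<partial>\<nu>) = inner z y"
    using riesz_representation by blast
  thus ?thesis using lifted_op_eqI[where z=z and K=K and \<nu>=\<nu>] by simp
qed

text \<open>The identity \<open>excess_eq\<close> for arbitrary positive measures, with the bracket
  recognized as an integral.\<close>

lemma J_excess:
  assumes \<nu>: "\<nu> \<in> pos_measures X"
  shows "J \<nu> - Jbar = bregman (lifted_op K \<nu>) + (\<integral>v. q v \<partial>\<nu>)"
proof -
  interpret finite_measure \<nu> using \<nu> by (simp add: pos_measures_def)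
  have "integrable \<nu> (\<lambda>v. inner (K v) (DF ybar))"
    by (rule pos_measures_integrable[OF \<nu> X_compact K_continuous])
  hence "(\<integral>v. q v \<partial>\<nu>) = measure \<nu> (space \<nu>) + inner (lifted_op K \<nu>) (DF ybar)"
    by (simp add: q_def inner_lifted_op[OF \<nu>])
  thus ?thesis
    using excess_eq[of "lifted_op K \<nu>" "measure \<nu> (space \<nu>)"] by (simp add: lifted_objective_def)
qed

lemma integral_q_nonneg:
  assumes \<nu>: "\<nu> \<in> pos_measures X"
  shows "0 \<le> (\<integral>v. q v \<partial>\<nu>)"
proof -
  have "sets \<nu> = sets (borel_of_topology X)" using \<nu> by (simp add: pos_measures_def)
  from sets_eq_imp_space_eq[OF this] show ?thesis
    using q_nonneg by (intro Bochner_Integration.integral_nonneg) simp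
qed

lemma Jbar_le: "\<nu> \<in> pos_measures X \<Longrightarrow> Jbar \<le> J \<nu>"
  using J_excess[of \<nu>] bregman_nonneg[of "lifted_op K \<nu>"] integral_q_nonneg[of \<nu>] by linarith

lemma J_optimal: "J (dirac_sum X I lam u) = Jbar"
  using I_finite u_in lam_pos K_continuous
  by (simp add: lifted_objective_dirac_sum less_imp_le Jbar_def weight_def flip: ybar_eq)

text \<open>Both terms of \<open>J_excess\<close> vanish. The integral of \<open>q\<close> being 0
  concentrates \<nu> on the points \<open>u i\<close>, the Bregman term fixes the observation as
  \<open>ybar\<close>, and the dual vectors recover the weights.\<close>

lemma minimizer_unique:
  assumes X: "t1_space X" and \<nu>: "\<nu> \<in> pos_measures X" and le: "J \<nu> \<le> Jbar"
  shows "\<nu> = dirac_sum X I lam u"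
proof -
  interpret finite_measure \<nu> using \<nu> by (simp add: pos_measures_def)
  have sets: "sets \<nu> = sets (borel_of_topology X)" using \<nu> by (simp add: pos_measures_def)
  have space: "space \<nu> = topspace X" using sets_eq_imp_space_eq[OF sets] by simp
  have zero: "bregman (lifted_op K \<nu>) = 0" "(\<integral>v. q v \<partial>\<nu>) = 0"
    using J_excess[OF \<nu>] bregman_nonneg[of "lifted_op K \<nu>"] integral_q_nonneg[OF \<nu>] le by linarith+
  have "AE v in \<nu>. q v = 0"
    using zero(2) q_nonneg space pos_measures_integrable[OF \<nu> X_compact q_continuous]
    by (subst (asm) integral_nonneg_eq_0_iff_AE) auto
  hence AE: "AE v in \<nu>. v \<in> u ` I"
    using AE_space by eventually_elim (use q_zero space in auto)
  have fin: "finite (u ` I)" using I_finite by simp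
  have single: "{u i} \<in> sets \<nu>" if "i \<in> I" for i
    unfolding sets using X u_in[OF that] by (intro closedin_borel_of_topology closedin_t1_singleton)
  define a where "a i = measure \<nu> {u i}" for i
  have eq: "\<nu> = dirac_sum X I a u"
  proof (rule measure_eqI)
    show "sets \<nu> = sets (dirac_sum X I a u)" using sets by simp
    fix E assume E: "E \<in> sets \<nu>"
    have "u ` {i \<in> I. u i \<in> E} = (\<Union>i\<in>{i \<in> I. u i \<in> E}. {u i})" by auto
    hence meas: "u ` {i \<in> I. u i \<in> E} \<in> sets \<nu>"
      using single I_finite by (auto intro!: sets.finite_UN)
    have "emeasure \<nu> E = emeasure \<nu> (u ` {i \<in> I. u i \<in> E})"
      using AE E meas by (intro emeasure_eq_AE) (auto elim!: eventually_mono)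
    also have "\<dots> = (\<Sum>v\<in>u ` {i \<in> I. u i \<in> E}. emeasure \<nu> {v})"
      using I_finite single by (intro emeasure_eq_sum_singleton) auto
    also have "\<dots> = (\<Sum>i\<in>{i \<in> I. u i \<in> E}. emeasure \<nu> {u i})"
      using u_inj by (subst sum.reindex) (auto simp: inj_on_def)
    also have "\<dots> = (\<Sum>i\<in>I. ennreal (a i) * indicator E (u i))"
      using I_finite by (intro sum.mono_neutral_cong_left) (auto simp: a_def emeasure_eq_measure indicator_def)
    also have "\<dots> = emeasure (dirac_sum X I a u) E"
      using I_finite u_in E sets by (simp add: emeasure_dirac_sum)
    finally show "emeasure \<nu> E = emeasure (dirac_sum X I a u) E" .
  qed
  obtain w where w: "\<And>i j. i \<in> I \<Longrightarrow> j \<in> I \<Longrightarrow> inner (w i) (K (u j)) = (if i = j then 1 else 0)"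
    using dual_vectors by blast
  have "lifted_op K \<nu> = (\<Sum>i\<in>I. a i *\<^sub>R K (u i))"
    unfolding eq using I_finite u_in K_continuous
    by (intro lifted_op_dirac_sum) (auto simp: a_def)
  hence "(\<Sum>i\<in>I. a i *\<^sub>R K (u i)) = ybar" using zero(1) bregman_zero by metis
  hence "a i = lam i" if "i \<in> I" for i
    using inner_dual_sum[OF w that, of a] inner_dual_ybar[OF w that] by simp
  thus ?thesis unfolding eq by (rule dirac_sum_cong)
qed

lemma residual_eq:
  assumes "X = Ext_topology G"
  shows "residual F K G \<nu> = J \<nu> - Jbar"
proof -
  have "(INF \<nu>\<in>pos_measures X. J \<nu>) = Jbar"
  proof (rule cInf_eq_minimum)
    show "Jbar \<in> J ` pos_measures X"
      using J_optimal dirac_sum_pos_measure I_finite u_in by (intro image_eqI[of _ _ "dirac_sum X I lam u"]) auto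
  qed (use Jbar_le in auto)
  thus ?thesis by (simp add: residual_def assms)
qed

end

subsection \<open>The PDAP algorithm\<close>

lemma eventually_linear_imp_geometric:
  fixes r :: "nat \<Rightarrow> real"
  assumes step: "\<And>k. k0 \<le> k \<Longrightarrow> r (Suc k) \<le> \<zeta> * r k" and "0 < \<zeta>" and nonneg: "0 \<le> r k0"
  shows "\<exists>c>0. \<forall>\<^sub>F k in sequentially. r k \<le> c * \<zeta> ^ k"
proof -
  have geo: "r (k0 + n) \<le> r k0 * \<zeta> ^ n" for n
  proof (induction n)
    case (Suc n)
    have "r (k0 + Suc n) \<le> \<zeta> * r (k0 + n)" using step[of "k0 + n"] by simp
    also have "\<dots> \<le> \<zeta> * (r k0 * \<zeta> ^ n)" using Suc \<open>0 < \<zeta>\<close> by simp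
    finally show ?case by (simp add: mult_ac)
  qed simp
  \<comment> \<open>The summand 1 keeps the constant positive when \<open>r k0\<close> is 0;
    division by \<open>\<zeta> ^ k0\<close> absorbs the starting index.\<close>
  have "r k \<le> ((r k0 + 1) / \<zeta> ^ k0) * \<zeta> ^ k" if "k0 \<le> k" for k
  proof -
    obtain n where k: "k = k0 + n" using le_Suc_ex[OF \<open>k0 \<le> k\<close>] by blast
    have "0 \<le> \<zeta> ^ n" using \<open>0 < \<zeta>\<close> by simp
    hence "r k \<le> (r k0 + 1) * \<zeta> ^ n"
      using geo[of n] unfolding k distrib_right by linarith
    also have "\<dots> = ((r k0 + 1) / \<zeta> ^ k0) * \<zeta> ^ k"
      using \<open>0 < \<zeta>\<close> by (simp add: k power_add)
    finally show ?thesis .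
  qed
  thus ?thesis
    using nonneg \<open>0 < \<zeta>\<close>
    by (intro exI[of _ "(r k0 + 1) / \<zeta> ^ k0"]) (auto simp: eventually_sequentially intro!: exI[of _ k0])
qed

text \<open>Strong continuity of \<open>K\<close> is given along sequences only. A sequence in the
  image lifts to the compact metric space, and a convergent subsequence there is mapped to a
  convergent one.\<close>

lemma (in Metric_space) compact_image_of_sequentially_continuous:
  fixes f :: "'a \<Rightarrow> 'b::metric_space"
  assumes "compact_space mtopology"
    and f: "\<And>w v. range w \<subseteq> M \<Longrightarrow> limitin mtopology w v sequentially \<Longrightarrow> (\<lambda>n. f (w n)) \<longlonglongrightarrow> f v"
  shows "compact (f ` M)"
  unfolding compact_def
proof (intro allI impI)
  fix g :: "nat \<Rightarrow> 'b" assume "\<forall>n. g n \<in> f ` M"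
  hence "\<forall>n. \<exists>x. x \<in> M \<and> g n = f x" by blast
  from choice[OF this] obtain w where w: "\<And>n. w n \<in> M" "\<And>n. g n = f (w n)" by blast
  hence "range w \<subseteq> M" by auto
  then obtain l \<rho> where l: "l \<in> M" "strict_mono \<rho>" "limitin mtopology (w \<circ> \<rho>) l sequentially"
    using assms(1) unfolding compact_space_sequentially by blast
  have "range (w \<circ> \<rho>) \<subseteq> M" using w(1) by auto
  from f[OF this l(3)] have "(g \<circ> \<rho>) \<longlonglongrightarrow> f l" using w(2) by (simp add: o_def)
  thus "\<exists>l\<in>f ` M. \<exists>\<rho>. strict_mono \<rho> \<and> (g \<circ> \<rho>) \<longlonglongrightarrow> l" using l by blast
qed

theorem theorem6p10:
  fixes F :: "'y::{real_inner,complete_space} \<Rightarrow> real"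
    and K :: "'c::banach dual \<Rightarrow> 'y"
    and Kpre :: "'y \<Rightarrow>\<^sub>L 'c"
    and G :: "'c dual \<Rightarrow> ennreal"
    and d :: "'c dual \<Rightarrow> 'c dual \<Rightarrow> real"
    and ubar :: "'c dual" and ybar :: 'y and pbar :: 'c
    and N :: nat and u :: "nat \<Rightarrow> 'c dual" and lam :: "nat \<Rightarrow> real"
    and g :: "'c dual \<Rightarrow> 'c dual \<Rightarrow> real" and \<tau> \<kappa> :: real
    and U :: "nat \<Rightarrow> 'c dual set"
    and A :: "nat \<Rightarrow> 'c dual set" and vhat :: "nat \<Rightarrow> 'c dual"
    and \<mu> :: "nat \<Rightarrow> 'c dual measure" and \<mu>bar :: "'c dual measure"
  (* setting *)
  assumes separable: "separable_space (euclidean :: 'c topology)"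
    and F_convex: "convex_on UNIV F"
    and K_linear: "linear K"
    and K_continuous: "continuous_map weak_star weak_topology K"
    and K_preadjoint: "\<And>y v. blinfun_apply v (blinfun_apply Kpre y) = inner (K v) y"
    and G_convex: "convex_ennreal G"
    and G_lsc: "lower_semicontinuous weak_star G"
    and G_homogeneous: "pos_homogeneous G"
    and d_metric: "Metric_space (Ext_closure G) d"
    and d_metrizes: "Metric_space.mtopology (Ext_closure G) d = Ext_topology G"
  (* (i) *)
    and F_bdd_below: "bdd_below (range F)"
    and F_strictly_convex: "strictly_convex F"
    and F_differentiable: "\<And>y. F differentiable (at y)"
    and gradient_lipschitz: "\<And>S. compact S \<Longrightarrow> \<exists>L. L-lipschitz_on S (gradient F)"
  (* (ii) *)
    and sublevel_compact: "\<And>\<alpha>::real. 0 \<le> \<alpha> \<Longrightarrow> compactin weak_star {v. G v \<le> ennreal \<alpha>}"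
  (* (iii) *)
    and K_strongly_continuous: "\<And>w v. (\<And>n. G (w n) < \<infinity>) \<Longrightarrow>
           limitin weak_star w v sequentially \<Longrightarrow> (\<lambda>n. K (w n)) \<longlonglongrightarrow> K v"
  (* minimizer, optimal observation and dual variable *)
    and ubar_minimizer: "is_arg_min (objective F K G) (\<lambda>_. True) ubar"
    and ybar_def: "ybar = K ubar"
    and pbar_def: "pbar = dual_variable F Kpre ybar"
  (* (iv) *)
    and strong_monotone: "\<exists>V \<theta>. ybar \<in> interior V \<and> 0 < \<theta> \<and>
           (\<forall>y1\<in>V. \<forall>y2\<in>V. inner (gradient F y1 - gradient F y2) (y1 - y2) \<ge> \<theta> * (norm (y1 - y2))\<^sup>2)"
  (* (v) *)
    and N_pos: "1 \<le> N"
    and u_distinct: "inj_on u {1..N}"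
    and u_Ext: "\<And>i. i \<in> {1..N} \<Longrightarrow> u i \<in> Ext G"
    and argmax_level: "{v. is_arg_max (\<lambda>v. blinfun_apply v pbar) (\<lambda>v. v \<in> Ext_closure G) v}
           = {v \<in> Ext_closure G. blinfun_apply v pbar = 1}"
    and argmax_points: "{v \<in> Ext_closure G. blinfun_apply v pbar = 1} = u ` {1..N}"
  (* (vi) *)
    and Ku_distinct: "inj_on (\<lambda>i. K (u i)) {1..N}"
    and Ku_independent: "independent ((\<lambda>i. K (u i)) ` {1..N})"
  (* (vii) *)
    and ubar_repr: "ubar = (\<Sum>i\<in>{1..N}. lam i *\<^sub>R u i)"
    and lam_pos: "\<And>i. i \<in> {1..N} \<Longrightarrow> 0 < lam i"
  (* (viii) *)
    and g_nonneg: "\<And>v w. v \<in> Ext G \<Longrightarrow> w \<in> Ext G \<Longrightarrow> 0 \<le> g v w"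
    and constants_pos: "0 < \<tau>" "0 < \<kappa>"
    and U_closed: "\<And>i. i \<in> {1..N} \<Longrightarrow> closedin (Metric_space.mtopology (Ext_closure G) d) (U i)"
    and U_nhd: "\<And>i. i \<in> {1..N} \<Longrightarrow>
           u i \<in> Metric_space.mtopology (Ext_closure G) d interior_of U i"
    and U_disjoint: "disjoint_family_on U {1..N}"
    and K_growth: "\<And>i v. i \<in> {1..N} \<Longrightarrow> v \<in> U i \<inter> Ext G \<Longrightarrow> norm (K (v - u i)) \<le> \<tau> * g v (u i)"
    and pbar_growth: "\<And>i v. i \<in> {1..N} \<Longrightarrow> v \<in> U i \<inter> Ext G \<Longrightarrow>
           1 - blinfun_apply v pbar \<ge> \<kappa> * (g v (u i))\<^sup>2"
  (* iterates *)
    and pdap: "pdap_sequence F K Kpre G A vhat \<mu>"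
    and \<mu>bar_def: "\<mu>bar = dirac_sum (Ext_topology G) {1..N} lam u"
  shows
    "is_arg_min (lifted_objective F K) (\<lambda>\<nu>. \<nu> \<in> pos_measures (Ext_topology G)) \<mu>bar \<and>
     (\<forall>\<nu>. is_arg_min (lifted_objective F K) (\<lambda>\<nu>. \<nu> \<in> pos_measures (Ext_topology G)) \<nu>
            \<longrightarrow> \<nu> = \<mu>bar) \<and>
     weak_star_converges (Ext_topology G) \<mu> \<mu>bar \<and>
     (\<exists>kbar. \<exists>\<zeta>\<in>{3/4..<1::real}.
        (\<forall>k\<ge>kbar. residual F K G (\<mu> (Suc k)) \<le> \<zeta> * residual F K G (\<mu> k)) \<and>
        (\<exists>c>0. \<forall>\<^sub>F k in sequentially. residual F K G (\<mu> k) \<le> c * \<zeta> ^ k))"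
proof -

  \<comment> \<open>Translation of the hypotheses to the abstract problem\<close>
  define X where "X = Ext_topology G"
  define DF where "DF = gradient F"
  interpret M: Metric_space "Ext_closure G" d by (rule d_metric)
  have topX: "topspace X = Ext_closure G"
    using d_metrizes M.topspace_mtopology by (simp add: X_def)
  have Ext_sub: "Ext G \<subseteq> Ext_closure G"
    unfolding Ext_closure_def by (rule closure_of_subset) (simp add: strong_operator_topology_topspace)
  have ball_closed: "closedin weak_star (unit_sublevel G)"
    using G_lsc unfolding lower_semicontinuous_def unit_sublevel_def
    by (simp add: strong_operator_topology_topspace)
  have Ext_ball: "Ext_closure G \<subseteq> unit_sublevel G"
    unfolding Ext_closure_def
    by (rule closure_of_minimal[OF _ ball_closed]) (auto simp: Ext_def extreme_point_of_def)
  have "compactin weak_star (unit_sublevel G)"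
    using sublevel_compact[of 1] by (simp add: unit_sublevel_def)
  hence "compactin weak_star (Ext_closure G)"
    by (rule closed_compactin[OF _ Ext_ball]) (simp add: Ext_closure_def)
  hence X_compact: "compact_space X"
    by (simp add: X_def Ext_topology_def compact_space_subtopology)
  have "Hausdorff_space X" using M.Hausdorff_space_mtopology d_metrizes by (simp add: X_def)
  hence X_t1: "t1_space X" by (rule Hausdorff_imp_t1_space)
  have pair_cont: "continuous_map X euclideanreal (\<lambda>v. blinfun_apply v p)" for p
    unfolding X_def Ext_topology_def
    by (intro continuous_map_from_subtopology strong_operator_topology_continuous_evaluation)
  have K_cont: "continuous_map X euclideanreal (\<lambda>v. inner (K v) y)" for y
    using pair_cont[of "Kpre y"] by (simp add: K_preadjoint)
  \<comment> \<open>Points of the closure have \<open>G\<close> at most 1, so the sequential strong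
    continuity applies to them.\<close>
  have "compact (K ` Ext_closure G)"
  proof (rule M.compact_image_of_sequentially_continuous)
    show "compact_space M.mtopology" using X_compact d_metrizes by (simp add: X_def)
    fix w v assume w: "range w \<subseteq> Ext_closure G" "limitin M.mtopology w v sequentially"
    have "G (w n) < \<infinity>" for n
    proof -
      have "G (w n) \<le> 1" using w(1) Ext_ball by (auto simp: unit_sublevel_def)
      thus ?thesis using order.strict_trans1 ennreal_one_less_top infinity_ennreal_def by metis
    qed
    moreover have "limitin weak_star w v sequentially"
      using w(2) unfolding d_metrizes Ext_topology_def by (simp add: limitin_subtopology)
    ultimately show "(\<lambda>n. K (w n)) \<longlonglongrightarrow> K v" by (rule K_strongly_continuous)
  qed
  hence K_compact: "compact (K ` topspace X)" by (simp add: topX)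
  have grad: "GDERIV F y :> DF y" for y
    unfolding DF_def by (rule GDERIV_gradient[OF F_differentiable])
  have u_X: "u i \<in> topspace X" if "i \<in> {1..N}" for i
    using u_Ext[OF that] Ext_sub by (auto simp: topX)
  have q_eq: "1 + inner (K v) (DF ybar) = 1 - blinfun_apply v pbar" for v
    by (simp add: pbar_def dual_variable_def DF_def blinfun.minus_right K_preadjoint)
  \<comment> \<open>The maximum over the closure is attained at \<open>u 1\<close>, where the
    pairing is 1.\<close>
  have pbar_le: "blinfun_apply v pbar \<le> 1" if "v \<in> topspace X" for v
  proof -
    have "u 1 \<in> {v \<in> Ext_closure G. blinfun_apply v pbar = 1}"
      unfolding argmax_points using N_pos by simp
    moreover from this have "is_arg_max (\<lambda>v. blinfun_apply v pbar) (\<lambda>v. v \<in> Ext_closure G) (u 1)"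
      using argmax_level by blast
    ultimately show ?thesis using that by (fastforce simp: is_arg_max_def topX not_less)
  qed
  have pbar_eq: "blinfun_apply v pbar = 1 \<longleftrightarrow> v \<in> u ` {1..N}" if "v \<in> topspace X" for v
    using argmax_points that by (auto simp: topX)
  have ybar_sum: "ybar = (\<Sum>i\<in>{1..N}. lam i *\<^sub>R K (u i))"
    unfolding ybar_def ubar_repr by (simp add: linear_sum[OF K_linear] linear_scale[OF K_linear])
  interpret dual_sparse_problem F DF K X "{1..N}" u lam ybar
  proof
    show "F y + inner (DF y) (z - y) \<le> F z" for y z
      by (rule convex_on_above_gradient[OF F_convex grad])
    show "F y + inner (DF y) (z - y) < F z" if "z \<noteq> y" for y z
      by (rule strictly_convex_above_gradient[OF F_convex F_strictly_convex grad that])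
    show "0 \<le> 1 + inner (K v) (DF ybar)" if "v \<in> topspace X" for v
      using pbar_le[OF that] by (simp add: q_eq)
    show "1 + inner (K v) (DF ybar) = 0 \<longleftrightarrow> v \<in> u ` {1..N}" if "v \<in> topspace X" for v
      using pbar_eq[OF that] by (simp add: q_eq)
  qed (use grad X_compact K_cont K_compact N_pos u_X u_distinct Ku_distinct Ku_independent lam_pos
      ybar_sum in auto)

  \<comment> \<open>The iterates as finite weighted sums\<close>
  define P :: "nat \<Rightarrow> 'c dual \<Rightarrow> real"
    where "P k v = blinfun_apply v (dual_variable F Kpre (lifted_op K (\<mu> k)))" for k v
  have A0: "finite (A 0)" "A 0 \<subseteq> Ext G"
    and vhat: "\<And>k. is_arg_max (P k) (\<lambda>v. v \<in> Ext G) (vhat k)"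
    and \<mu>: "\<And>k. is_arg_min J (\<lambda>\<nu>. \<nu> \<in> pos_measures_on X (insert (vhat k) (A k))) (\<mu> (Suc k))"
    and A_Suc: "\<And>k. A (Suc k) = msupport X (\<mu> (Suc k))"
    using pdap unfolding pdap_sequence_def Let_def P_def X_def by blast+
  have vhat_Ext: "vhat k \<in> Ext G" for k using vhat[of k] by (simp add: is_arg_max_def)
  have "\<exists>a. (\<forall>v\<in>insert (vhat k) (A k). 0 \<le> a v)
      \<and> \<mu> (Suc k) = dirac_sum X (insert (vhat k) (A k)) a (\<lambda>v. v)" for k
    using \<mu>[of k] by (auto simp: is_arg_min_def pos_measures_on_def)
  then obtain a where a: "\<And>k v. v \<in> insert (vhat k) (A k) \<Longrightarrow> 0 \<le> a k v"
    "\<And>k. \<mu> (Suc k) = dirac_sum X (insert (vhat k) (A k)) (a k) (\<lambda>v. v)" by metis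
  have supp: "A (Suc k) = {v \<in> insert (vhat k) (A k). 0 < a k v}"
    if "finite (A k)" "A k \<subseteq> Ext G" for k
    unfolding A_Suc a(2) using that vhat_Ext Ext_sub a(1)
    by (intro msupport_dirac_sum[OF X_t1]) (auto simp: topX)
  have A: "finite (A k) \<and> A k \<subseteq> Ext G" for k
  proof (induction k)
    case (Suc k)
    thus ?case using supp[of k] vhat_Ext[of k] by auto
  qed (use A0 in simp)
  have A_fin: "finite (A k)" and A_Ext: "A k \<subseteq> Ext G" for k using A by blast+
  have A_X: "v \<in> topspace X" if "v \<in> insert (vhat k) (A k)" for k v
    using that A_Ext vhat_Ext Ext_sub by (auto simp: topX)
  have A_supp: "A (Suc k) = {v \<in> insert (vhat k) (A k). 0 < a k v}" for k
    using supp A by blast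
  have \<mu>_eq: "\<mu> (Suc k) = dirac_sum X (A (Suc k)) (a k) (\<lambda>v. v)" for k
    unfolding a(2)
  proof (rule dirac_sum_mono_neutral)
    show "a k v = 0" if "v \<in> insert (vhat k) (A k) - A (Suc k)" for v
      using that a(1)[of v k] A_supp[of k] by force
  qed (use A_fin A_supp in auto)
  have a_pos: "0 < a k v" if "v \<in> A (Suc k)" for k v using that A_supp[of k] by simp
  have op_eq: "lifted_op K (\<mu> (Suc k)) = (\<Sum>v\<in>A (Suc k). a k v *\<^sub>R K v)" for k
    unfolding \<mu>_eq using A_fin A_X a_pos K_cont
    by (intro lifted_op_dirac_sum) (auto simp: less_imp_le)
  have J_eq: "J (\<mu> (Suc k)) = F (\<Sum>v\<in>A (Suc k). a k v *\<^sub>R K v) + sum (a k) (A (Suc k))" for k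
    unfolding \<mu>_eq using A_fin A_X a_pos K_cont
    by (intro lifted_objective_dirac_sum) (auto simp: less_imp_le)
  \<comment> \<open>Weights on any subset \<open>T\<close> of the enlarged active set become
    admissible after extension by 0. \<open>T = A (Suc k)\<close> yields \<open>optimal\<close>; the
    full enlarged set, one index later, yields \<open>optimal_Suc\<close>.\<close>
  have J_le: "J (\<mu> (Suc k)) \<le> F (\<Sum>v\<in>T. e v *\<^sub>R K v) + sum e T"
    if T: "T \<subseteq> insert (vhat k) (A k)" and e: "\<And>v. v \<in> T \<Longrightarrow> 0 \<le> e v" for k T e
  proof -
    define e' where "e' v = (if v \<in> T then e v else 0)" for v
    have fin: "finite T" using T A_fin finite_subset by blast
    have "dirac_sum X (insert (vhat k) (A k)) e' (\<lambda>v. v)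
        \<in> pos_measures_on X (insert (vhat k) (A k))"
      using e by (auto simp: pos_measures_on_def e'_def)
    hence "J (\<mu> (Suc k)) \<le> J (dirac_sum X (insert (vhat k) (A k)) e' (\<lambda>v. v))"
      using \<mu>[of k] by (auto simp: is_arg_min_def not_less)
    also have "dirac_sum X (insert (vhat k) (A k)) e' (\<lambda>v. v) = dirac_sum X T e' (\<lambda>v. v)"
      using T A_fin by (intro dirac_sum_mono_neutral) (auto simp: e'_def)
    also have "\<dots> = dirac_sum X T e (\<lambda>v. v)" by (rule dirac_sum_cong) (simp add: e'_def)
    also have "J \<dots> = F (\<Sum>v\<in>T. e v *\<^sub>R K v) + sum e T"
      using fin T A_X K_cont e by (intro lifted_objective_dirac_sum) auto
    finally show ?thesis .
  qed
  have P_eq: "P (Suc k) v = - inner (K v) (DF (\<Sum>v\<in>A (Suc k). a k v *\<^sub>R K v))" for k v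
    by (simp add: P_def op_eq dual_variable_def DF_def blinfun.minus_right K_preadjoint)
  \<comment> \<open>The index is shifted by one: the initial measure is arbitrary, so optimality on
    the active set holds only from \<open>\<mu> (Suc 0)\<close> on.\<close>
  interpret sparse_iteration F DF K X "{1..N}" u lam ybar "Ext G" "\<lambda>k. A (Suc k)" a
    "\<lambda>k. vhat (Suc k)"
  proof
    show "bdd_below (range F)" by (rule F_bdd_below)
    show "\<exists>L. L-lipschitz_on S DF" if "compact S" for S
      unfolding DF_def by (rule gradient_lipschitz[OF that])
    show "Ext G \<subseteq> topspace X" using Ext_sub topX by simp
    show "inner (K (vhat (Suc k))) (DF (\<Sum>v\<in>A (Suc k). a k v *\<^sub>R K v))
        \<le> inner (K v) (DF (\<Sum>v\<in>A (Suc k). a k v *\<^sub>R K v))" if "v \<in> Ext G" for k v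
      using vhat[of "Suc k"] that by (auto simp: is_arg_max_def P_eq not_less)
    show "F (\<Sum>v\<in>A (Suc k). a k v *\<^sub>R K v) + sum (a k) (A (Suc k))
        \<le> F (\<Sum>v\<in>A (Suc k). e v *\<^sub>R K v) + sum e (A (Suc k))"
      if "\<And>v. v \<in> A (Suc k) \<Longrightarrow> 0 \<le> e v" for k e
      using J_le[of "A (Suc k)" k e] that A_supp[of k] by (auto simp: J_eq)
    show "F (\<Sum>v\<in>A (Suc (Suc k)). a (Suc k) v *\<^sub>R K v) + sum (a (Suc k)) (A (Suc (Suc k)))
        \<le> F (\<Sum>v\<in>insert (vhat (Suc k)) (A (Suc k)). e v *\<^sub>R K v)
          + sum e (insert (vhat (Suc k)) (A (Suc k)))"
      if "\<And>v. v \<in> insert (vhat (Suc k)) (A (Suc k)) \<Longrightarrow> 0 \<le> e v" for k e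
      using J_le[of "insert (vhat (Suc k)) (A (Suc k))" "Suc k" e] that by (simp only: J_eq)
  qed (use A_fin A_Ext a_pos u_Ext vhat_Ext in auto)

  \<comment> \<open>Transfer of the conclusions to the lifted problem\<close>
  have residual: "residual F K G (\<mu> (Suc k)) = r k" for k
    unfolding residual_eq[OF X_def] J_eq r_def y_def mass_def ..
  have \<mu>bar_in: "\<mu>bar \<in> pos_measures X"
    unfolding \<mu>bar_def X_def[symmetric] using u_X by (intro dirac_sum_pos_measure) auto
  have \<mu>bar_J: "J \<mu>bar = Jbar" using J_optimal by (simp add: \<mu>bar_def X_def)
  have weak: "weak_star_converges X \<mu> \<mu>bar"
    unfolding weak_star_converges_def
  proof (intro allI impI)
    fix f assume f: "continuous_map X euclideanreal f"
    note f_meas = continuous_map_borel_measurable[OF f]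
    have "(\<integral>v. f v \<partial>\<mu> (Suc k)) = (\<Sum>v\<in>A (Suc k). a k v * f v)" for k
      unfolding \<mu>_eq using A_fin A_X a_pos f_meas
      by (intro integral_dirac_sum) (auto simp: less_imp_le)
    moreover have "(\<integral>v. f v \<partial>\<mu>bar) = (\<Sum>i\<in>{1..N}. lam i * f (u i))"
      unfolding \<mu>bar_def X_def[symmetric] using u_X lam_pos f_meas
      by (intro integral_dirac_sum) (auto simp: less_imp_le)
    ultimately have "(\<lambda>k. \<integral>v. f v \<partial>\<mu> (Suc k)) \<longlonglongrightarrow> (\<integral>v. f v \<partial>\<mu>bar)"
      using weak_convergence[OF f] by simp
    thus "(\<lambda>k. \<integral>v. f v \<partial>\<mu> k) \<longlonglongrightarrow> (\<integral>v. f v \<partial>\<mu>bar)" by (rule LIMSEQ_imp_Suc)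
  qed
  obtain V \<theta> where V: "ybar \<in> interior V" "0 < \<theta>"
    "\<And>y1 y2. y1 \<in> V \<Longrightarrow> y2 \<in> V \<Longrightarrow>
      \<theta> * (norm (y1 - y2))\<^sup>2 \<le> inner (gradient F y1 - gradient F y2) (y1 - y2)"
    using strong_monotone by blast
  obtain \<delta> where \<delta>: "0 < \<delta>" "ball ybar \<delta> \<subseteq> V" using V(1) mem_interior by blast
  obtain \<zeta> where \<zeta>: "\<zeta> \<in> {3/4..<1}" "\<forall>\<^sub>F k in sequentially. r (Suc k) \<le> \<zeta> * r k"
  proof (rule linear_convergence[of \<delta> \<theta> \<tau> \<kappa> U g])
    show "\<theta> * (norm (a - b))\<^sup>2 \<le> inner (DF a - DF b) (a - b)"
      if "a \<in> ball ybar \<delta>" "b \<in> ball ybar \<delta>" for a b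
      unfolding DF_def using V(3) \<delta>(2) that by blast
    show "u i \<in> X interior_of U i" if "i \<in> {1..N}" for i
      using U_nhd[OF that] by (simp add: d_metrizes X_def)
    show "norm (K v - K (u i)) \<le> \<tau> * g v (u i)" if "i \<in> {1..N}" "v \<in> U i \<inter> Ext G" for i v
      using K_growth[OF that] by (simp add: linear_diff[OF K_linear])
    show "\<kappa> * (g v (u i))\<^sup>2 \<le> q v" if "i \<in> {1..N}" "v \<in> U i \<inter> Ext G" for i v
      using pbar_growth[OF that] by (simp add: q_def q_eq)
  qed (use \<delta> V g_nonneg constants_pos in auto)
  have "\<forall>\<^sub>F k in sequentially. residual F K G (\<mu> (Suc (Suc k))) \<le> \<zeta> * residual F K G (\<mu> (Suc k))"
    using \<zeta>(2) by (simp add: residual)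
  hence "\<forall>\<^sub>F k in sequentially. residual F K G (\<mu> (Suc k)) \<le> \<zeta> * residual F K G (\<mu> k)"
    by (simp add: eventually_sequentially_Suc[of "\<lambda>k. residual F K G (\<mu> (Suc k)) \<le> \<zeta> * residual F K G (\<mu> k)"])
  then obtain k0 where "\<And>k. k0 \<le> k \<Longrightarrow> residual F K G (\<mu> (Suc k)) \<le> \<zeta> * residual F K G (\<mu> k)"
    by (auto simp: eventually_sequentially)
  \<comment> \<open>From \<open>Suc k0\<close> on, the residuals are values of \<open>r\<close>, so
    the geometric estimate starts from a nonnegative number.\<close>
  hence step: "residual F K G (\<mu> (Suc k)) \<le> \<zeta> * residual F K G (\<mu> k)" if "Suc k0 \<le> k" for k
    using that by simp
  have geo: "\<exists>c>0. \<forall>\<^sub>F k in sequentially. residual F K G (\<mu> k) \<le> c * \<zeta> ^ k"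
    using \<zeta>(1) r_nonneg
    by (intro eventually_linear_imp_geometric[of "Suc k0" "\<lambda>k. residual F K G (\<mu> k)"] step)
      (auto simp: residual)
  have minimizer: "is_arg_min J (\<lambda>\<nu>. \<nu> \<in> pos_measures X) \<mu>bar"
    using \<mu>bar_in \<mu>bar_J Jbar_le by (auto simp: is_arg_min_def not_less)
  have unique: "\<nu> = \<mu>bar" if "is_arg_min J (\<lambda>\<nu>. \<nu> \<in> pos_measures X) \<nu>" for \<nu>
  proof -
    have "\<nu> \<in> pos_measures X" "J \<nu> \<le> Jbar"
      using that \<mu>bar_in \<mu>bar_J by (auto simp: is_arg_min_def not_less)
    thus ?thesis using minimizer_unique[OF X_t1] by (simp add: \<mu>bar_def X_def)
  qed
  show ?thesis
    unfolding X_def[symmetric]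
  proof (intro conjI allI impI exI[of _ "Suc k0"] bexI[of _ \<zeta>])
  qed (fact minimizer unique weak step geo \<zeta>(1))+
qed

end
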